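(* Let $d\ge 3$ be an integer and let $\emptyset\ne S\subseteq V(\mathbb{T}_d)$ be an arbitrary non-empty subset of the vertices of the $d$-regular tree $\mathbb{T}_d$ with root $o$. Let $S^{\mathrm{even}}$ (respectively $S^{\mathrm{odd}}$) be the subset of vertices of $S$ at even (respectively odd) distance from $o$. Then: (1) With $\alpha(S)=\limsup_{t\to\infty}a_t(S)^{1/t}$ and $\beta(S)=\limsup_{t\to\infty}b_t(S)^{1/t}$, one has $\beta(S)=g_d(\alpha(S))$. (2) The same formula holds for ordinary limits: (a) If $\tilde\alpha(S)=\lim_{t\to\infty}a_t(S)^{1/t}$ exists and $S^{\mathrm{even}}\neq\emptyset$ and $S^{\mathrm{odd}}\ne\emptyset$, then $\tilde\beta(S)=\lim_{t\to\infty}b_t(S)^{1/t}$ exists and $\tilde\beta(S)=g_d(\tilde\alpha(S))$. (b) If $\tilde\alpha^{\mathrm{even}}(S)=\lim_{t\to\infty}a_{2t}(S)^{1/(2t)}$ exists and $S^{\mathrm{even}}\ne\emptyset$, then $\tilde\beta^{\mathrm{even}}(S)=\lim_{t\to\infty}b_{2t}(S)^{1/(2t)}$ exists and $\tilde\beta^{\mathrm{even}}(S)=g_d(\tilde\alpha^{\mathrm{even}}(S))$. (c) If $\tilde\alpha^{\mathrm{odd}}(S)=\lim_{t\to\infty}a_{2t+1}(S)^{1/(2t+1)}$ exists and $S^{\mathrm{odd}}\ne\emptyset$, then $\tilde\beta^{\mathrm{odd}}(S)=\lim_{t\to\infty}b_{2t+1}(S)^{1/(2t+1)}$ exists and $\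tilde\beta^{\mathrm{odd}}(S)=g_d(\tilde\alpha^{\mathrm{odd}}(S))$.
   Context: $\mathbb{T}_d$ is the (infinite) $d$-regular tree with a fixed root vertex $o$. For $S\subseteq V(\mathbb{T}_d)$: $a_t(S)$ is the number of non-backtracking walks of length $t$ in $\mathbb{T}_d$ that begin at $o$ and end in $S$ (equivalently, the number of elements of $S$ at distance $t$ from $o$); $b_t(S)$ is the number of arbitrary (not necessarily non-backtracking) walks of length $t$ in $\mathbb{T}_d$ that begin at $o$ and end in $S$. The map $g_d\colon\mathbb{R}_{\ge0}\to[2\sqrt{d-1},\infty)$ is defined by $g_d(\alpha)=2\sqrt{d-1}$ if $\alpha\le\sqrt{d-1}$, and $g_d(\alpha)=\alpha+\frac{d-1}{\alpha}$ if $\alpha\ge\sqrt{d-1}$. *)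

theory Defs
  imports "HOL-Analysis.Analysis"
begin

text \<open>
  Graphs are simple and undirected, given by a vertex set V and a symmetric irreflexive
  relation E. A walk is the list of its vertices, so a walk of length t has t + 1 entries.
\<close>

definition walk :: "'a set \<Rightarrow> ('a \<times> 'a) set \<Rightarrow> 'a list \<Rightarrow> bool" where
  "walk V E p \<longleftrightarrow> p \<noteq> [] \<and> set p \<subseteq> V \<and> successively (\<lambda>u v. (u, v) \<in> E) p"

definition nonbacktracking :: "'a list \<Rightarrow> bool" where
  "nonbacktracking p \<longleftrightarrow> (\<forall>i. i + 2 < length p \<longrightarrow> p ! i \<noteq> p ! (i + 2))"

text \<open>The closing vertex of a cycle is not repeated in the list.\<close>

definition is_cycle :: "'a set \<Rightarrow> ('a \<times> 'a) set \<Rightarrow> 'a list \<Rightarrow> bool" where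
  "is_cycle V E p \<longleftrightarrow>
     3 \<le> length p \<and> walk V E p \<and> distinct p \<and> (last p, hd p) \<in> E"

text \<open>
  Up to isomorphism there is exactly one d-regular tree, so a statement about it is a statement
  about an arbitrary instance of the following locale; an instance for each d is given at the
  end of this theory. The Graph_Theory notion of a tree is not used because, for
  symmetric digraphs, it counts u, v, u as a cycle.
\<close>

locale regular_tree =
  fixes V :: "'a set" and E :: "('a \<times> 'a) set" and d :: nat
  assumes edges_subset: "E \<subseteq> V \<times> V"
    and sym_edges: "sym E"
    and irrefl_edges: "irrefl E"
    and connected: "\<And>u v. u \<in> V \<Longrightarrow> v \<in> V \<Longrightarrow> \<exists>p. walk V E p \<and> hd p = u \<and> last p = v"
    and no_cycle: "\<And>p. \<not> is_cycle V E p"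
    and finite_neighbours: "\<And>v. v \<in> V \<Longrightarrow> finite {w. (v, w) \<in> E}"
    and regular: "\<And>v. v \<in> V \<Longrightarrow> card {w. (v, w) \<in> E} = d"

definition graph_dist :: "'a set \<Rightarrow> ('a \<times> 'a) set \<Rightarrow> 'a \<Rightarrow> 'a \<Rightarrow> nat" where
  "graph_dist V E u v =
     (LEAST n. \<exists>p. walk V E p \<and> length p = Suc n \<and> hd p = u \<and> last p = v)"

definition even_part :: "'a set \<Rightarrow> ('a \<times> 'a) set \<Rightarrow> 'a \<Rightarrow> 'a set \<Rightarrow> 'a set" where
  "even_part V E r S = {v \<in> S. even (graph_dist V E r v)}"

definition odd_part :: "'a set \<Rightarrow> ('a \<times> 'a) set \<Rightarrow> 'a \<Rightarrow> 'a set \<Rightarrow> 'a set" where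
  "odd_part V E r S = {v \<in> S. odd (graph_dist V E r v)}"

definition walks_into ::
  "'a set \<Rightarrow> ('a \<times> 'a) set \<Rightarrow> 'a \<Rightarrow> 'a set \<Rightarrow> nat \<Rightarrow> 'a list set" where
  "walks_into V E r S t =
     {p. walk V E p \<and> length p = Suc t \<and> hd p = r \<and> last p \<in> S}"

definition nb_walk_count :: "'a set \<Rightarrow> ('a \<times> 'a) set \<Rightarrow> 'a \<Rightarrow> 'a set \<Rightarrow> nat \<Rightarrow> nat" where
  "nb_walk_count V E r S t = card {p \<in> walks_into V E r S t. nonbacktracking p}"

definition walk_count :: "'a set \<Rightarrow> ('a \<times> 'a) set \<Rightarrow> 'a \<Rightarrow> 'a set \<Rightarrow> nat \<Rightarrow> nat" where
  "walk_count V E r S t = card (walks_into V E r S t)"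

text \<open>Only arguments \<open>\<alpha> \<ge> 0\<close> are meaningful.\<close>

definition g :: "nat \<Rightarrow> real \<Rightarrow> real" where
  "g d \<alpha> = (if \<alpha> \<le> sqrt (real d - 1) then 2 * sqrt (real d - 1)
            else \<alpha> + (real d - 1) / \<alpha>)"


text \<open>
  The d-regular tree: its vertices are the words over d letters without two equal consecutive
  letters, and a word is joined to the words obtained from it by prepending a letter.
\<close>

definition word_verts :: "nat \<Rightarrow> nat list set" where
  "word_verts d = {w. set w \<subseteq> {..<d} \<and> successively (\<noteq>) w}"

definition word_edges :: "nat \<Rightarrow> (nat list \<times> nat list) set" where
  "word_edges d = {(u, v) \<in> word_verts d \<times> word_verts d. (\<exists>x. v = x # u) \<or> (\<exists>x. u = x # v)}"

lemma walk_rev: "sym E \<Longrightarrow> walk V E p \<Longrightarrow> walk V E (rev p)"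
  unfolding walk_def sym_def by (auto elim: successively_mono)

lemma word_walk_to_Nil:
  "w \<in> word_verts d \<Longrightarrow> \<exists>p. walk (word_verts d) (word_edges d) p \<and> hd p = w \<and> last p = []"
proof (induction w)
  case Nil
  then show ?case by (intro exI[of _ "[[]]"]) (auto simp: walk_def)
next
  case (Cons x w)
  then have w: "w \<in> word_verts d" by (auto simp: word_verts_def successively_Cons)
  with Cons obtain p where p: "walk (word_verts d) (word_edges d) p" "hd p = w" "last p = []"
    by blast
  have "(x # w, w) \<in> word_edges d" using w Cons.prems by (auto simp: word_edges_def)
  with p Cons.prems show ?case
    by (intro exI[of _ "(x # w) # p"]) (auto simp: walk_def successively_Cons)
qed

lemma word_no_cycle: "\<not> is_cycle (word_verts d) (word_edges d) p"
proof
  assume c: "is_cycle (word_verts d) (word_edges d) p"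
  define n where "n = length p"
  have n: "n \<ge> 3" "p \<noteq> []" and dist: "distinct p" and cl: "(last p, hd p) \<in> word_edges d"
    and ch: "successively (\<lambda>u v. (u, v) \<in> word_edges d) p"
    using c by (auto simp: is_cycle_def walk_def n_def)
  have step: "(p ! i, p ! (Suc i mod n)) \<in> word_edges d" if "i < n" for i
  proof (cases "Suc i = n")
    case True
    then have "i = length p - Suc 0" "Suc i mod n = 0" by (auto simp: n_def)
    then show ?thesis using cl n by (simp add: last_conv_nth hd_conv_nth)
  next
    case False
    then show ?thesis using ch that by (auto simp: successively_conv_nth n_def)
  qed
  obtain i where i: "i < n" "\<And>j. j < n \<Longrightarrow> length (p ! j) \<le> length (p ! i)"
    using n ex_is_arg_min_if_finite[of "{..<n}" "\<lambda>j. - int (length (p ! j))"]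
    by (force simp: is_arg_min_linorder lessThan_empty_iff)
  define j where "j = Suc i mod n"
  define k where "k = (if i = 0 then n - 1 else i - 1)"
  have jk: "j < n" "k < n" "j \<noteq> k" and ki: "Suc k mod n = i"
    using n i(1) by (auto simp: j_def k_def mod_Suc)
  have "p ! j = tl (p ! i)" using step[OF i(1)] i(2)[OF jk(1)]
    by (auto simp: word_edges_def j_def)
  moreover have "p ! k = tl (p ! i)" using step[OF jk(2)] i(2)[OF jk(2)]
    by (auto simp: word_edges_def ki)
  ultimately show False using dist jk by (metis nth_eq_iff_index_eq n_def)
qed

lemma word_neighbours:
  assumes "w \<in> word_verts d"
  shows "finite {v. (w, v) \<in> word_edges d}" "card {v. (w, v) \<in> word_edges d} = d"
proof -
  have "finite {v. (w, v) \<in> word_edges d} \<and> card {v. (w, v) \<in> word_edges d} = d"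
  proof (cases w)
    case Nil
    have "{v. (w, v) \<in> word_edges d} = (\<lambda>x. [x]) ` {..<d}"
      using Nil by (auto simp: word_edges_def word_verts_def)
    then show ?thesis by (simp add: card_image inj_on_def)
  next
    case (Cons y u)
    have y: "y < d" using assms Cons by (auto simp: word_verts_def)
    have "{v. (w, v) \<in> word_edges d} = insert u ((\<lambda>x. x # w) ` ({..<d} - {y}))"
      using assms Cons by (auto simp: word_edges_def word_verts_def successively_Cons)
    moreover have "u \<notin> (\<lambda>x. x # w) ` ({..<d} - {y})" using Cons by auto
    ultimately show ?thesis using y by (simp add: card_image inj_on_def)
  qed
  then show "finite {v. (w, v) \<in> word_edges d}" "card {v. (w, v) \<in> word_edges d} = d" by auto
qed

lemma regular_tree_words: "regular_tree (word_verts d) (word_edges d) d"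
proof
  show s: "sym (word_edges d)" by (auto simp: sym_def word_edges_def)
  show "word_edges d \<subseteq> word_verts d \<times> word_verts d" by (auto simp: word_edges_def)
  show "irrefl (word_edges d)" by (auto simp: irrefl_def word_edges_def)
  fix u v assume "u \<in> word_verts d" "v \<in> word_verts d"
  then obtain p q where p: "walk (word_verts d) (word_edges d) p" "hd p = u" "last p = []"
    and q: "walk (word_verts d) (word_edges d) q" "hd q = v" "last q = []"
    using word_walk_to_Nil by metis
  have q': "walk (word_verts d) (word_edges d) (rev q)" using walk_rev[OF s q(1)] .
  have ne: "p \<noteq> []" "q \<noteq> []" using p q by (auto simp: walk_def)
  show "\<exists>p. walk (word_verts d) (word_edges d) p \<and> hd p = u \<and> last p = v"
  proof (cases "tl (rev q) = []")
    case True
    then have "q = [hd q]" using ne by (cases q rule: rev_cases) auto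
    then have "v = []" using q by (metis last.simps)
    then show ?thesis using p by blast
  next
    case False
    obtain z where z: "rev q = [] # z" using q ne by (cases q rule: rev_cases) auto
    have "walk (word_verts d) (word_edges d) (p @ z)"
      using p q' z ne False
      by (auto simp: walk_def successively_append_iff successively_Cons)
    moreover have "hd (p @ z) = u" using p ne by simp
    moreover have "last (p @ z) = v"
      using False z q ne by (metis last_ConsR last_appendR last_rev list.sel(3))
    ultimately show ?thesis by blast
  qed
qed (use word_no_cycle word_neighbours in auto)

end

theory Submission
  imports Defs
begin

text \<open>
  Write \<open>q = d - 1\<close> and let \<open>N n k\<close> be the number of walks of length \<open>n\<close> from the root to a fixed
  vertex at distance \<open>k\<close>, so that \<open>b n = (\<Sum>k\<le>n. a k * N n k)\<close>. For \<open>\<beta> \<ge> 1\<close> the recursion of \<open>N\<close>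
  gives \<open>N n k \<le> (\<beta> + q / \<beta>) ^ n / \<beta> ^ k\<close>, which yields all upper bounds.
  A single vertex of \<open>S\<close> already forces growth \<open>2 * sqrt q\<close>, by the ballot numbers. For
  \<open>\<beta> > sqrt q\<close> the function \<open>\<beta> ^ (k + 1) - (q / \<beta>) ^ (k + 1)\<close> is a subsolution for the adjacency
  operator with eigenvalue \<open>\<beta> + q / \<beta>\<close>; it bounds \<open>(\<Sum>k. \<beta> ^ k * N n k)\<close> from below, which
  handles ordinary limits. For upper limits, the Green function \<open>\<Sum>n. N n k / (\<beta> + q / \<beta>) ^ n\<close> is at
  least \<open>1 / \<beta> ^ k\<close>, so fast growth of \<open>a\<close> makes \<open>\<Sum>n. b n / (\<beta> + q / \<beta>) ^ n\<close> diverge.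
\<close>

section \<open>Walk numbers of the regular tree\<close>

text \<open>
  \<open>tree_walks q n k\<close> counts the walks of length \<open>n\<close> from the root of the \<open>(q + 1)\<close>-regular tree to a
  given vertex at distance \<open>k\<close>, by the last step of the walk.
\<close>

fun tree_walks :: "nat \<Rightarrow> nat \<Rightarrow> nat \<Rightarrow> nat" where
  "tree_walks q 0 k = (if k = 0 then 1 else 0)"
| "tree_walks q (Suc n) 0 = Suc q * tree_walks q n 1"
| "tree_walks q (Suc n) (Suc k) = tree_walks q n k + q * tree_walks q n (Suc (Suc k))"

lemma tree_walks_eq_0: "n < k \<or> odd (n + k) \<Longrightarrow> tree_walks q n k = 0"
  by (induction q n k rule: tree_walks.induct) (auto simp: odd_pos)

text \<open>Away from the root the right-hand side satisfies the recursion of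
  \<open>tree_walks\<close> with equality. At the root the recursion only gives an inequality,
  \<open>(1 + q) / \<beta> \<le> \<beta> + q / \<beta>\<close>, which is where
  \<open>1 \<le> \<beta>\<close> enters.\<close>

lemma tree_walks_le:
  fixes \<beta> :: real
  assumes "1 \<le> \<beta>"
  shows "real (tree_walks q n k) \<le> (\<beta> + q / \<beta>) ^ n / \<beta> ^ k"
proof (induction q n k rule: tree_walks.induct)
  case (1 q k)
  then show ?case using assms by simp
next
  case (2 q n)
  have "1 / \<beta> \<le> \<beta>" using assms by (simp add: field_simps mult_mono order_trans[of 1 \<beta>])
  then have *: "(1 + real q) / \<beta> \<le> \<beta> + q / \<beta>" by (simp add: add_divide_distrib)
  have "real (tree_walks q (Suc n) 0) = (1 + real q) * real (tree_walks q n 1)"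
    by (simp add: algebra_simps)
  also have "\<dots> \<le> (1 + real q) * ((\<beta> + q / \<beta>) ^ n / \<beta> ^ 1)"
    using 2 by (intro mult_left_mono) auto
  also have "\<dots> = (1 + real q) / \<beta> * (\<beta> + q / \<beta>) ^ n" by simp
  also have "\<dots> \<le> (\<beta> + q / \<beta>) * (\<beta> + q / \<beta>) ^ n"
    using * assms by (intro mult_right_mono) auto
  finally show ?case by simp
next
  case (3 q n k)
  let ?\<rho> = "\<beta> + q / \<beta>"
  have "real (tree_walks q (Suc n) (Suc k)) \<le>
      ?\<rho> ^ n / \<beta> ^ k + real q * (?\<rho> ^ n / \<beta> ^ Suc (Suc k))"
    using 3 mult_left_mono[OF 3(2), of "real q"] by simp
  also have "\<dots> = ?\<rho> ^ Suc n / \<beta> ^ Suc k"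
    using assms by (simp add: field_simps)
  finally show ?case .
qed

text \<open>\<open>\<beta> = sqrt q\<close> minimises \<open>\<beta> + q / \<beta>\<close>, with
  value \<open>2 * sqrt q\<close>.\<close>

lemma tree_walks_le_sqrt:
  assumes "1 \<le> q"
  shows "real (tree_walks q n k) \<le> (2 * sqrt q) ^ n"
proof -
  have "real (tree_walks q n k) \<le> (sqrt q + q / sqrt q) ^ n / sqrt q ^ k"
    by (rule tree_walks_le) (use assms in simp)
  also have "\<dots> = (2 * sqrt q) ^ n / sqrt q ^ k" by (simp add: real_div_sqrt)
  also have "\<dots> \<le> (2 * sqrt q) ^ n / 1"
    using assms by (intro divide_left_mono) auto
  finally show ?thesis by simp
qed

text \<open>
  Replacing the factor \<open>Suc q\<close> at the root by \<open>q\<close> turns \<open>tree_walks\<close> into weighted ballot numbers.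
  The subtracted binomial coefficient is moved to the right-hand side to stay within the naturals.
\<close>

lemma tree_walks_ballot:
  "k + 2 * m = n \<Longrightarrow>
    q ^ m * (n choose m) \<le> tree_walks q n k + q ^ m * (if m = 0 then 0 else n choose (m - 1))"
proof (induction n arbitrary: k m)
  case 0
  then show ?case by simp
next
  case (Suc n)
  show ?case
  proof (cases m)
    case 0
    then have "k = Suc n" using Suc.prems by simp
    then show ?thesis using Suc.IH[of n 0] 0 by simp
  next
    case (Suc j)
    have *: "q ^ j * (n choose j) * q \<le>
        (tree_walks q n (Suc k) + q ^ j * (if j = 0 then 0 else n choose (j - 1))) * q"
      using Suc.IH[of "Suc k" j] Suc.prems Suc by (intro mult_right_mono) auto
    have pascal: "Suc n choose j = (n choose j) + (if j = 0 then 0 else n choose (j - 1))"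
      by (cases j) auto
    show ?thesis
    proof (cases k)
      case 0
      \<comment> \<open>At the root only the bound for distance 1 is available. Since
        \<open>Suc n = 2 * m\<close>, the two middle binomial coefficients of \<open>n\<close>
        coincide, and after Pascal's rule one copy of \<open>n choose j\<close> cancels.\<close>
      then have "n - j = Suc j" "j \<le> n" using Suc.prems Suc by auto
      then have "n choose (Suc j) = n choose j"
        using binomial_symmetric[of j n] by simp
      then show ?thesis using * 0 Suc
        by (simp add: pascal algebra_simps)
    next
      case (Suc i)
      have "q ^ Suc j * (n choose Suc j) \<le> tree_walks q n i + q ^ Suc j * (n choose j)"
        using Suc.IH[of i "Suc j"] Suc.prems Suc \<open>m = Suc j\<close> by simp
      then show ?thesis using * Suc \<open>m = Suc j\<close>
        by (simp add: pascal algebra_simps)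
    qed
  qed
qed

text \<open>Following a closed walk by the outward path to the vertex is injective; in the recursion
  this is the first summand.\<close>

lemma tree_walks_0_le: "tree_walks q n 0 \<le> tree_walks q (n + k) k"
  by (induction k) (auto intro: le_trans)

text \<open>At distance 0 the ballot difference is \<open>q ^ m\<close> times the Catalan number
  \<open>(2 * m choose m) / (m + 1)\<close>, and the central binomial coefficient is at least
  \<open>4 ^ m / (2 * m)\<close>. Larger distances follow by \<open>tree_walks_0_le\<close>.\<close>

lemma tree_walks_ge:
  assumes "0 < m"
  shows "(4 * real q) ^ m / (2 * real m * (real m + 1)) \<le> real (tree_walks q (2 * m + k) k)"
proof -
  obtain j where j: "m = Suc j" using assms by (cases m) auto
  have "Suc j * (2 * m choose Suc j) = (2 * m - j) * (2 * m choose j)"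
    using binomial_absorb_comp[of "2 * m" j] binomial_absorption[of j "2 * m"] by simp
  then have "m * (2 * m choose m) = (m + 1) * (2 * m choose j)"
    using j by (simp del: binomial_Suc_Suc)
  then have "real (m * (2 * m choose m)) = real ((m + 1) * (2 * m choose j))" by (rule arg_cong)
  then have "real m * real (2 * m choose m) = (real m + 1) * real (2 * m choose j)"
    by (simp only: of_nat_mult of_nat_add of_nat_1)
  then have c: "real (2 * m choose j) = real m * real (2 * m choose m) / (real m + 1)"
    by (simp add: field_simps)
  have "real q ^ m * real (2 * m choose m) \<le>
      real (tree_walks q (2 * m) 0) + real q ^ m * real (2 * m choose j)"
    using tree_walks_ballot[of 0 m "2 * m" q] j assms
    by (simp flip: of_nat_mult of_nat_add of_nat_power)
  then have "real q ^ m * (real (2 * m choose m) / (real m + 1)) \<le> real (tree_walks q (2 * m) 0)"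
    unfolding c by (simp add: field_simps)
  moreover have "real q ^ m * ((4 ^ m / (2 * real m)) / (real m + 1)) \<le>
      real q ^ m * (real (2 * m choose m) / (real m + 1))"
    by (intro mult_left_mono divide_right_mono central_binomial_lower_bound assms) auto
  moreover have "real (tree_walks q (2 * m) 0) \<le> real (tree_walks q (2 * m + k) k)"
    using tree_walks_0_le by simp
  ultimately show ?thesis by (simp add: power_mult_distrib mult.commute)
qed

text \<open>\<open>\<psi>\<close> combines the two exponential solutions of
  \<open>f (k + 2) + q * f k = (\<beta> + q / \<beta>) * f (k + 1)\<close> so as to vanish at 0.
  Hence the sum of \<open>tree_walks q n k * \<psi> (k + 1)\<close> grows at least by the factor
  \<open>\<beta> + q / \<beta>\<close> in each step, and \<open>\<psi>\<close> is dominated by the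
  powers of \<open>\<beta>\<close>.\<close>

lemma sum_tree_walks_ge:
  fixes \<beta> :: real
  assumes "1 \<le> \<beta>" "real q < \<beta>\<^sup>2"
  shows "(1 - q / \<beta>\<^sup>2) * (\<beta> + q / \<beta>) ^ n \<le> (\<Sum>k\<le>n. \<beta> ^ k * real (tree_walks q n k))"
proof -
  define \<psi> where "\<psi> k = \<beta> ^ k - (q / \<beta>) ^ k" for k
  have [simp]: "\<psi> 0 = 0" by (simp add: \<psi>_def)
  have "q / \<beta> < \<beta>" using assms by (simp add: field_simps power2_eq_square)
  then have pos: "0 \<le> \<psi> k" for k
    using assms by (auto simp: \<psi>_def intro!: power_mono)
  have rec: "\<psi> (k + 2) + q * \<psi> k = (\<beta> + q / \<beta>) * \<psi> (k + 1)" for k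
    using assms by (simp add: \<psi>_def field_simps)
  have "(\<beta> + q / \<beta>) ^ n * \<psi> 1 \<le> (\<Sum>k\<le>n. real (tree_walks q n k) * \<psi> (k + 1))"
  proof (induction n)
    case 0
    then show ?case by simp
  next
    case (Suc n)
    let ?N = "\<lambda>k. real (tree_walks q n k)"
    have "(\<beta> + q / \<beta>) * (\<Sum>k\<le>n. ?N k * \<psi> (k + 1)) =
        (\<Sum>k\<le>n. ?N k * \<psi> (k + 2)) + q * (\<Sum>k\<le>n. ?N k * \<psi> k)"
      unfolding sum_distrib_left sum.distrib[symmetric]
    proof (intro sum.cong refl)
      fix k
      have "(\<beta> + q / \<beta>) * (?N k * \<psi> (k + 1)) = ?N k * ((\<beta> + q / \<beta>) * \<psi> (k + 1))" by simp
      then show "(\<beta> + q / \<beta>) * (?N k * \<psi> (k + 1)) = ?N k * \<psi> (k + 2) + q * (?N k * \<psi> k)"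
        unfolding rec[symmetric] by (simp add: algebra_simps)
    qed
    \<comment> \<open>The added terms are zero because a walk of length \<open>n\<close> cannot get
      beyond distance \<open>n\<close>; afterwards \<open>\<psi> 0 = 0\<close> removes the first
      term of the shifted sum.\<close>
    also have "(\<Sum>k\<le>n. ?N k * \<psi> k) = (\<Sum>k\<le>Suc (Suc n). ?N k * \<psi> k)"
      by (simp add: tree_walks_eq_0)
    also have "\<dots> = ?N 1 * \<psi> 1 + (\<Sum>k\<le>n. ?N (k + 2) * \<psi> (k + 2))"
      unfolding sum.atMost_Suc_shift by simp
    \<comment> \<open>The sides differ by \<open>?N 1 * \<psi> 1\<close>, which stems from the
      factor \<open>Suc q\<close> instead of \<open>q\<close> at the root.\<close>
    also have "(\<Sum>k\<le>n. ?N k * \<psi> (k + 2)) + q * (?N 1 * \<psi> 1 + (\<Sum>k\<le>n. ?N (k + 2) * \<psi> (k + 2)))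
        \<le> (1 + q) * ?N 1 * \<psi> 1 + (\<Sum>k\<le>n. (?N k + q * ?N (k + 2)) * \<psi> (k + 2))"
      using pos[of 1] by (simp add: algebra_simps sum.distrib sum_distrib_left)
    also have "\<dots> = (\<Sum>k\<le>Suc n. real (tree_walks q (Suc n) k) * \<psi> (k + 1))"
      unfolding sum.atMost_Suc_shift by (simp add: algebra_simps)
    finally have "(\<beta> + q / \<beta>) * (\<Sum>k\<le>n. ?N k * \<psi> (k + 1)) \<le> \<dots>" .
    moreover have "(\<beta> + q / \<beta>) * ((\<beta> + q / \<beta>) ^ n * \<psi> 1) \<le>
        (\<beta> + q / \<beta>) * (\<Sum>k\<le>n. ?N k * \<psi> (k + 1))"
      using Suc assms by (intro mult_left_mono) auto
    ultimately show ?case by simp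
  qed
  also have "\<dots> \<le> (\<Sum>k\<le>n. real (tree_walks q n k) * \<beta> ^ (k + 1))"
    using assms by (intro sum_mono mult_left_mono) (auto simp: \<psi>_def)
  also have "\<dots> = \<beta> * (\<Sum>k\<le>n. \<beta> ^ k * real (tree_walks q n k))"
    by (simp add: sum_distrib_left algebra_simps)
  finally have "\<beta> * ((1 - q / \<beta>\<^sup>2) * (\<beta> + q / \<beta>) ^ n) \<le> \<dots>"
    using assms by (simp add: \<psi>_def algebra_simps power2_eq_square)
  then show ?thesis using assms by simp
qed

lemma two_sqrt_less:
  fixes q :: nat and \<beta> :: real
  assumes "0 < \<beta>" "sqrt q < \<beta>"
  shows "2 * sqrt q < \<beta> + q / \<beta>"
proof -
  have "0 < (\<beta> - sqrt q)\<^sup>2 / \<beta>" using assms by simp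
  also have "\<dots> = \<beta> + (sqrt q)\<^sup>2 / \<beta> - 2 * sqrt q"
    using assms by (simp add: field_simps power2_eq_square)
  finally show ?thesis by simp
qed

text \<open>
  Rescaled by \<open>\<beta> ^ k\<close>, the Green function at distance \<open>k\<close> has increments forming a geometric
  progression of ratio \<open>\<beta>\<^sup>2 / q > 1\<close>; being nonnegative, it cannot decrease.
\<close>

lemma tree_green_ge:
  fixes \<beta> :: real
  assumes q: "1 \<le> q" and \<beta>: "sqrt q < \<beta>"
  defines "z \<equiv> 1 / (\<beta> + q / \<beta>)"
  shows "summable (\<lambda>n. real (tree_walks q n k) * z ^ n)"
    and "1 / \<beta> ^ k \<le> (\<Sum>n. real (tree_walks q n k) * z ^ n)"
proof -
  have "0 < sqrt q" using q by simp
  then have \<beta>0: "0 < \<beta>" using \<beta> by linarith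
  have z0: "0 < z" using \<beta>0 by (simp add: z_def add_pos_nonneg)
  \<comment> \<open>\<open>tree_walks q n k\<close> is at most \<open>(2 * sqrt q) ^ n\<close>, so
    this places \<open>z\<close> strictly inside the disc of convergence.\<close>
  have small: "2 * sqrt q * z < 1"
    using two_sqrt_less[OF \<beta>0 \<beta>] z0 by (simp add: z_def)
  have summ: "summable (\<lambda>n. real (tree_walks q n k) * z ^ n)" for k
  proof (rule summable_comparison_test')
    show "summable (\<lambda>n. (2 * sqrt q * z) ^ n)"
      using small z0 by (intro summable_geometric) simp
    show "norm (real (tree_walks q n k) * z ^ n) \<le> (2 * sqrt q * z) ^ n" if "0 \<le> n" for n
      using tree_walks_le_sqrt[OF q, of n k] z0 by (simp add: power_mult_distrib)
  qed
  show "summable (\<lambda>n. real (tree_walks q n k) * z ^ n)" by (rule summ)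
  define G where "G k = (\<Sum>n. real (tree_walks q n k) * z ^ n)" for k
  have G_nonneg: "0 \<le> G k" for k
    unfolding G_def using z0 by (intro suminf_nonneg summ) auto
  \<comment> \<open>The walk of length 0 contributes the 1; this is all that is used about the
    root.\<close>
  have "G 0 = 1 + (\<Sum>n. real (tree_walks q (Suc n) 0) * z ^ Suc n)"
    unfolding G_def using suminf_split_head[OF summ, of 0] by simp
  moreover have "0 \<le> (\<Sum>n. real (tree_walks q (Suc n) 0) * z ^ Suc n)"
    using z0 by (intro suminf_nonneg summable_Suc_iff[THEN iffD2, OF summ[of 0]]) simp
  ultimately have G0: "1 \<le> G 0" by simp
  have G_rec: "G (Suc k) = z * (G k + q * G (k + 2))" for k
  proof -
    have "G (Suc k) = (\<Sum>n. real (tree_walks q (Suc n) (Suc k)) * z ^ Suc n)"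
      unfolding G_def using suminf_split_head[OF summ, of "Suc k"] by simp
    also have "\<dots> = (\<Sum>n. z * (real (tree_walks q n k) * z ^ n +
        q * (real (tree_walks q n (k + 2)) * z ^ n)))"
      by (simp add: algebra_simps)
    also have "\<dots> = z * (G k + q * G (k + 2))"
      unfolding G_def using summ
      by (subst suminf_mult, force intro: summable_add summable_mult)
         (subst suminf_add[symmetric], auto simp: suminf_mult summable_mult)
    finally show ?thesis .
  qed
  define h where "h k = G k * \<beta> ^ k" for k
  define D where "D k = h (Suc k) - h k" for k
  \<comment> \<open>The coefficients on the right add up to the one on the left, so this becomes a
    first-order recursion for the increments \<open>D\<close>.\<close>
  have h_rec: "(\<beta> + q / \<beta>) * h (Suc k) = \<beta> * h k + q / \<beta> * h (k + 2)" for k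
  proof -
    have "\<beta> + q / \<beta> \<noteq> 0" using z0 by (auto simp: z_def)
    then have "(\<beta> + q / \<beta>) * G (Suc k) = G k + q * G (k + 2)"
      unfolding G_rec z_def by simp
    then have "(\<beta> + q / \<beta>) * G (Suc k) * \<beta> ^ Suc k = (G k + q * G (k + 2)) * \<beta> ^ Suc k" by simp
    then show ?thesis using \<beta>0 by (simp add: h_def algebra_simps)
  qed
  have x: "1 \<le> \<beta>\<^sup>2 / q"
    using \<beta> q real_less_rsqrt[of "real q" \<beta>] by (simp add: real_sqrt_less_iff sqrt_le_D less_imp_le)
  have D_rec: "D (Suc k) = \<beta>\<^sup>2 / q * D k" for k
    using h_rec[of k] \<beta>0 q unfolding D_def by (simp add: field_simps power2_eq_square)
  have D: "D k = (\<beta>\<^sup>2 / q) ^ k * D 0" for k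
    by (induction k) (simp_all add: D_rec)
  have h: "h k = h 0 + (\<Sum>j<k. D j)" for k
    by (induction k) (simp_all add: D_def)
  have "0 \<le> D 0"
  proof (rule ccontr)
    assume "\<not> 0 \<le> D 0"
    then have neg: "0 < - D 0" by simp
    obtain n where n: "h 0 < real n * (- D 0)"
      using reals_Archimedean3[OF neg] by auto
    have "D j \<le> D 0" for j
      using neg one_le_power[OF x, of j] mult_right_mono_neg[of 1 "(\<beta>\<^sup>2 / q) ^ j" "D 0"]
      unfolding D[of j] by simp
    then have "(\<Sum>j<n. D j) \<le> real n * D 0"
      using sum_bounded_above[of "{..<n}" D "D 0"] by simp
    then have "h n < 0" using n unfolding h[of n] by simp
    then show False using G_nonneg[of n] \<beta>0 by (simp add: h_def mult_less_0_iff)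
  qed
  then have "0 \<le> D j" for j using x unfolding D[of j] by simp
  then have "h 0 \<le> h k" unfolding h[of k] by (simp add: sum_nonneg)
  then have "1 \<le> G k * \<beta> ^ k" using G0 by (simp add: h_def)
  then show "1 / \<beta> ^ k \<le> (\<Sum>n. real (tree_walks q n k) * z ^ n)"
    using \<beta>0 unfolding G_def[symmetric] by (simp add: field_simps)
qed

section \<open>Growth rates\<close>

lemma root_less_iff_power:
  fixes x y :: real
  assumes "0 < n" "0 \<le> y"
  shows "root n x < y \<longleftrightarrow> x < y ^ n" and "y < root n x \<longleftrightarrow> y ^ n < x"
  using assms real_root_less_iff[of n x "y ^ n"] real_root_less_iff[of n "y ^ n" x]
  by (simp_all add: real_root_power_cancel)

text \<open>A strict gap between exponential rates absorbs constants and quadratic factors, such as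
  the number of summands of \<open>b n\<close> or the denominator in
  \<open>tree_walks_ge\<close>.\<close>

lemma eventually_power_less:
  fixes \<sigma> \<rho> c :: real
  assumes "0 \<le> \<sigma>" "\<sigma> < \<rho>" "0 < c"
  shows "\<forall>\<^sub>F n in sequentially. \<sigma> ^ n < c * \<rho> ^ n / (real n + 1)\<^sup>2"
proof -
  \<comment> \<open>With the square root of the ratio, the known limit of \<open>n * x ^ n\<close>
    can be squared to produce the quadratic factor.\<close>
  define x where "x = sqrt (\<sigma> / \<rho>)"
  have x: "0 \<le> x" "x < 1" and x2: "x\<^sup>2 = \<sigma> / \<rho>" using assms by (auto simp: x_def)
  have "(\<lambda>n. (real n * x ^ n + x ^ n)\<^sup>2) \<longlonglongrightarrow> (0 + 0)\<^sup>2"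
    using x by (intro tendsto_intros LIMSEQ_power_zero powser_times_n_limit_0) auto
  then have "\<forall>\<^sub>F n in sequentially. (real n * x ^ n + x ^ n)\<^sup>2 < c"
    using assms(3) by (intro order_tendstoD(2)[of _ 0]) auto
  then show ?thesis
  proof eventually_elim
    case (elim n)
    have "(real n * x ^ n + x ^ n)\<^sup>2 = (real n + 1)\<^sup>2 * (x\<^sup>2) ^ n"
    proof -
      have "real n * x ^ n + x ^ n = (real n + 1) * x ^ n" by (simp add: algebra_simps)
      moreover have "(x ^ n)\<^sup>2 = (x\<^sup>2) ^ n" by (simp only: mult.commute flip: power_mult)
      ultimately show ?thesis by (simp add: power_mult_distrib)
    qed
    also have "\<dots> = (real n + 1)\<^sup>2 * \<sigma> ^ n / \<rho> ^ n" by (simp add: x2 power_divide)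
    finally have "(real n + 1)\<^sup>2 * \<sigma> ^ n / \<rho> ^ n < c" using elim by simp
    then show ?case using assms by (simp add: field_simps)
  qed
qed

lemma eventually_power_less':
  fixes \<sigma> \<rho> c :: real
  assumes "0 \<le> \<sigma>" "\<sigma> < \<rho>" "0 < c"
  shows "\<forall>\<^sub>F n in sequentially. \<sigma> ^ n < c * \<rho> ^ n"
  using eventually_power_less[OF assms]
proof eventually_elim
  case (elim n)
  have "c * \<rho> ^ n / (real n + 1)\<^sup>2 \<le> c * \<rho> ^ n / 1"
    using assms by (intro divide_left_mono) auto
  then show ?case using elim by simp
qed

text \<open>Limits along \<open>2 * t + e\<close> become statements about all \<open>n\<close> of
  one parity, the form in which \<open>tree_walks_eq_0\<close> applies without reindexing.\<close>

lemma eventually_parity_iff: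
  fixes e :: nat
  assumes "e \<le> 1"
  shows "(\<forall>\<^sub>F t in sequentially. P (2 * t + e)) \<longleftrightarrow>
    (\<forall>\<^sub>F n in sequentially. even (n + e) \<longrightarrow> P n)"
proof
  assume "\<forall>\<^sub>F t in sequentially. P (2 * t + e)"
  then obtain T where T: "\<And>t. T \<le> t \<Longrightarrow> P (2 * t + e)" by (auto simp: eventually_sequentially)
  have "P n" if "2 * T + e \<le> n" "even (n + e)" for n
  proof -
    have "even (n - e)" using that assms by auto
    then obtain t where "n - e = 2 * t" by (rule evenE)
    then have "n = 2 * t + e" "T \<le> t" using that by auto
    then show ?thesis using T[of t] by simp
  qed
  then show "\<forall>\<^sub>F n in sequentially. even (n + e) \<longrightarrow> P n" by (auto simp: eventually_sequentially)
next
  assume "\<forall>\<^sub>F n in sequentially. even (n + e) \<longrightarrow> P n"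
  then obtain N where N: "\<And>n. N \<le> n \<Longrightarrow> even (n + e) \<Longrightarrow> P n" by (auto simp: eventually_sequentially)
  have "P (2 * t + e)" if "N \<le> t" for t using N[of "2 * t + e"] that by simp
  then show "\<forall>\<^sub>F t in sequentially. P (2 * t + e)" by (auto simp: eventually_sequentially)
qed

text \<open>At \<open>x = sqrt q\<close> the expression \<open>x + q / x\<close> equals
  \<open>2 * sqrt q\<close>, so both branches of \<open>g\<close> are values of one expression and
  the upper bounds need no case split.\<close>

lemma g_Suc: "g (Suc q) \<alpha> = max \<alpha> (sqrt q) + q / max \<alpha> (sqrt q)"
  by (auto simp: g_def max_def real_div_sqrt)

text \<open>Continuity from the right. The slack is needed because a limit \<open>\<alpha>\<close>
  only bounds the roots eventually by numbers above \<open>\<alpha>\<close>.\<close>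

lemma ex_greater_add_divide_less:
  fixes q \<beta> \<rho> :: real
  assumes "0 < \<beta>" "\<beta> + q / \<beta> < \<rho>"
  shows "\<exists>\<gamma>>\<beta>. \<gamma> + q / \<gamma> < \<rho>"
proof -
  have "((\<lambda>x. x + q / x) \<longlongrightarrow> \<beta> + q / \<beta>) (at_right \<beta>)"
    using assms by (intro tendsto_intros) auto
  then have "\<forall>\<^sub>F x in at_right \<beta>. x + q / x < \<rho>" using assms(2) by (rule order_tendstoD)
  then have "\<forall>\<^sub>F x in at_right \<beta>. \<beta> < x \<and> x + q / x < \<rho>"
    using eventually_at_right_less[of \<beta>] by eventually_elim simp
  then show ?thesis using eventually_happens[of _ "at_right \<beta>"] by auto
qed

lemma ex_between_less_add_divide:
  fixes q \<beta> \<rho> s :: real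
  assumes "0 \<le> s" "s < \<beta>" "\<rho> < \<beta> + q / \<beta>"
  shows "\<exists>\<gamma>>s. \<gamma> < \<beta> \<and> \<rho> < \<gamma> + q / \<gamma>"
proof -
  have "((\<lambda>x. x + q / x) \<longlongrightarrow> \<beta> + q / \<beta>) (at_left \<beta>)"
    using assms by (intro tendsto_intros) auto
  then have "\<forall>\<^sub>F x in at_left \<beta>. \<rho> < x + q / x" using assms(3) by (rule order_tendstoD)
  then have "\<forall>\<^sub>F x in at_left \<beta>. s < x \<and> x < \<beta> \<and> \<rho> < x + q / x"
    using eventually_at_left_real[OF assms(2)] by eventually_elim simp
  then show ?thesis using eventually_happens[of _ "at_left \<beta>"] by auto
qed

section \<open>Transfer of growth rates from \<open>a\<close> to \<open>b\<close>, with the tree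
  entering only through the sum formula\<close>

locale tree_walk_transform =
  fixes q :: nat and a b :: "nat \<Rightarrow> nat"
  assumes q: "1 \<le> q"
    and b: "b n = (\<Sum>k\<le>n. a k * tree_walks q n k)"
begin

lemma sqrt_q: "1 \<le> sqrt q"
  using q by simp

lemma max_sqrt_q_pos: "0 < max \<alpha> (sqrt q)"
  using sqrt_q by linarith

lemma g_pos: "0 < g (Suc q) \<alpha>"
  unfolding g_Suc using max_sqrt_q_pos[of \<alpha>]
  by (intro add_pos_nonneg divide_nonneg_nonneg) (simp_all only: less_imp_le of_nat_0_le_iff)

lemma b_ge: "a k * tree_walks q n k \<le> b n"
proof (cases "k \<le> n")
  case True
  then show ?thesis unfolding b by (intro member_le_sum) auto
next
  case False
  then show ?thesis by (simp add: tree_walks_eq_0)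
qed

text \<open>Each of the \<open>n + 1\<close> summands of \<open>b n\<close> is at most a constant
  times \<open>\<beta> ^ k * ((\<beta> + q / \<beta>) ^ n / \<beta> ^ k)\<close>, where
  \<open>k\<close> cancels. The closure condition on \<open>J\<close> covers a parity class as well
  as all indices, so the lemma serves ordinary and upper limits alike.\<close>

lemma walk_root_less:
  assumes J: "\<And>n k. J n \<Longrightarrow> even (n + k) \<Longrightarrow> J k"
    and \<beta>: "sqrt q \<le> \<beta>" and \<rho>: "\<beta> + q / \<beta> < \<rho>"
    and ev: "\<forall>\<^sub>F k in sequentially. J k \<longrightarrow> root k (a k) < \<beta>"
  shows "\<forall>\<^sub>F n in sequentially. J n \<longrightarrow> root n (b n) < \<rho>"
proof -
  have \<beta>1: "1 \<le> \<beta>" using sqrt_q \<beta> by linarith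
  obtain K where K: "\<And>k. K \<le> k \<Longrightarrow> J k \<Longrightarrow> root k (a k) < \<beta>"
    using ev by (auto simp: eventually_sequentially)
  \<comment> \<open>The sum takes care of the finitely many indices outside the eventual bound;
    adding 1 makes \<open>C\<close> at least 1 for the remaining ones.\<close>
  define C where "C = 1 + (\<Sum>k\<le>K. real (a k))"
  have C: "1 \<le> C" by (simp add: C_def sum_nonneg)
  have a_le: "real (a k) \<le> C * \<beta> ^ k" if "J k" for k
  proof (cases "k \<le> K")
    case True
    have "real (a k) \<le> (\<Sum>k\<le>K. real (a k))" using True by (intro member_le_sum) auto
    also have "\<dots> \<le> C * 1" by (simp add: C_def)
    also have "\<dots> \<le> C * \<beta> ^ k" using C \<beta>1 by (intro mult_left_mono) auto
    finally show ?thesis .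
  next
    case False
    then have "real (a k) < \<beta> ^ k" using K[of k] that \<beta>1 by (simp add: root_less_iff_power)
    also have "\<dots> \<le> C * \<beta> ^ k" using C \<beta>1 by simp
    finally show ?thesis by simp
  qed
  let ?\<rho> = "\<beta> + q / \<beta>"
  have b_le: "real (b n) \<le> (real n + 1) * (C * ?\<rho> ^ n)" if "J n" for n
  proof -
    have "real (a k) * real (tree_walks q n k) \<le> C * ?\<rho> ^ n" for k
    proof (cases "even (n + k)")
      case True
      have "real (a k) * real (tree_walks q n k) \<le> (C * \<beta> ^ k) * (?\<rho> ^ n / \<beta> ^ k)"
        using a_le[OF J[OF that True]] tree_walks_le[OF \<beta>1] C \<beta>1 by (intro mult_mono) auto
      then show ?thesis using \<beta>1 by simp
    next
      case False
      then show ?thesis using C \<beta>1 by (simp add: tree_walks_eq_0)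
    qed
    then have "(\<Sum>k\<le>n. real (a k) * real (tree_walks q n k)) \<le> real (card {..n}) * (C * ?\<rho> ^ n)"
      by (intro sum_bounded_above)
    then show ?thesis by (simp add: b add.commute)
  qed
  have \<rho>0: "0 \<le> ?\<rho>" using \<beta>1 by simp
  have "\<forall>\<^sub>F n in sequentially. ?\<rho> ^ n < (1 / C) * \<rho> ^ n / (real n + 1)\<^sup>2"
    using \<rho>0 \<rho> C by (intro eventually_power_less) auto
  then show ?thesis using eventually_gt_at_top[of 0]
  proof eventually_elim
    case (elim n)
    show ?case
    proof
      assume "J n"
      have "(real n + 1) * (C * ?\<rho> ^ n) \<le> (real n + 1)\<^sup>2 * (C * ?\<rho> ^ n)"
        using C \<rho>0 by (intro mult_right_mono) (auto simp: power2_eq_square)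
      also have "\<dots> < \<rho> ^ n" using elim C by (simp add: field_simps)
      finally show "root n (b n) < \<rho>"
        using b_le[OF \<open>J n\<close>] elim \<rho>0 \<rho> by (simp add: root_less_iff_power)
    qed
  qed
qed

text \<open>One non-empty sphere of \<open>S\<close> suffices: \<open>b n\<close> is at least
  \<open>tree_walks q n k\<close>, which for \<open>n\<close> of the parity of \<open>k\<close> has
  exponential rate \<open>2 * sqrt q\<close> up to a quadratic factor.\<close>

lemma less_walk_root_base:
  assumes "0 < a k" "0 \<le> \<rho>" "\<rho> < 2 * sqrt q"
  shows "\<forall>\<^sub>F n in sequentially. even (n + k) \<longrightarrow> \<rho> < root n (b n)"
proof -
  \<comment> \<open>The constant compensates for the \<open>k\<close> steps by which
    \<open>n\<close> exceeds \<open>2 * m\<close> below.\<close>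
  have "\<forall>\<^sub>F n in sequentially.
      \<rho> ^ n < (1 / (2 * sqrt q) ^ k) * (2 * sqrt q) ^ n / (real n + 1)\<^sup>2"
    using assms q by (intro eventually_power_less) auto
  then show ?thesis using eventually_ge_at_top[of "k + 2"]
  proof eventually_elim
    case (elim n)
    show ?case
    proof
      assume "even (n + k)"
      then have "even (n - k)" using elim by auto
      then obtain m where "n - k = 2 * m" by (rule evenE)
      then have n: "n = 2 * m + k" and m: "0 < m" using elim by auto
      have "(2 * sqrt q) ^ n = ((2 * sqrt q)\<^sup>2) ^ m * (2 * sqrt q) ^ k"
        by (simp add: n power_add power_mult)
      then have "\<rho> ^ n < (4 * real q) ^ m / (real n + 1)\<^sup>2"
        using elim q by (simp add: power_mult_distrib)
      also have "\<dots> \<le> (4 * real q) ^ m / (2 * real m * (real m + 1))"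
      proof (rule divide_left_mono)
        show "2 * real m * (real m + 1) \<le> (real n + 1)\<^sup>2"
          by (simp add: n power2_eq_square algebra_simps)
      qed (use m in simp_all)
      also have "\<dots> \<le> real (tree_walks q n k)" unfolding n by (rule tree_walks_ge[OF m])
      also have "\<dots> \<le> real (a k * tree_walks q n k)" using assms(1) by (simp del: of_nat_mult)
      also have "\<dots> \<le> real (b n)" using b_ge of_nat_le_iff by blast
      finally show "\<rho> < root n (b n)" using assms elim by (simp add: root_less_iff_power)
    qed
  qed
qed

text \<open>Compare \<open>b n\<close> with the sum in \<open>sum_tree_walks_ge\<close>. Only
  indices below \<open>K\<close> can violate \<open>\<beta> ^ k \<le> a k\<close>, and they
  contribute at most a multiple of \<open>(2 * sqrt q) ^ n\<close>, of lower exponential order by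
  \<open>two_sqrt_less\<close>.\<close>

lemma less_walk_root:
  assumes \<beta>: "sqrt q < \<beta>" and \<rho>: "0 \<le> \<rho>" "\<rho> < \<beta> + q / \<beta>"
    and ev: "\<forall>\<^sub>F k in sequentially. even (k + e) \<longrightarrow> \<beta> < root k (a k)"
  shows "\<forall>\<^sub>F n in sequentially. even (n + e) \<longrightarrow> \<rho> < root n (b n)"
proof -
  have \<beta>1: "1 \<le> \<beta>" using sqrt_q \<beta> by linarith
  have "\<forall>\<^sub>F k in sequentially. even (k + e) \<longrightarrow> \<beta> ^ k \<le> a k"
    using ev eventually_gt_at_top[of 0]
    by eventually_elim (use \<beta>1 in \<open>auto simp: root_less_iff_power\<close>)
  then obtain K where K: "\<And>k. K \<le> k \<Longrightarrow> even (k + e) \<Longrightarrow> \<beta> ^ k \<le> a k"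
    by (auto simp: eventually_sequentially)
  let ?\<rho> = "\<beta> + q / \<beta>"
  define c where "c = 1 - q / \<beta>\<^sup>2"
  have q_less: "real q < \<beta>\<^sup>2" using power_strict_mono[OF \<beta>, of 2] by simp
  then have c: "0 < c" using \<beta>1 by (simp add: c_def)
  \<comment> \<open>There are at most \<open>K\<close> exceptional summands, each at most
    \<open>\<beta> ^ K * (2 * sqrt q) ^ n\<close>; the added 1 keeps \<open>M\<close> positive as a
    divisor.\<close>
  define M where "M = real K * \<beta> ^ K + 1"
  have M: "0 < M" using \<beta>1 by (simp add: M_def add_nonneg_pos)
  have b_ge: "c * ?\<rho> ^ n - M * (2 * sqrt q) ^ n \<le> real (b n)" if n: "even (n + e)" for n
  proof -
    let ?r = "\<lambda>k. if k < K then \<beta> ^ K * (2 * sqrt q) ^ n else 0"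
    have "\<beta> ^ k * real (tree_walks q n k) \<le> real (a k) * real (tree_walks q n k) + ?r k" for k
    proof -
      consider "k < K" | "K \<le> k" "even (k + e)" | "odd (n + k)"
        using n by (metis even_add not_le)
      then show ?thesis
      proof cases
        case 1
        have "\<beta> ^ k * real (tree_walks q n k) \<le> \<beta> ^ K * (2 * sqrt q) ^ n"
          using 1 \<beta>1 tree_walks_le_sqrt[OF q] by (intro mult_mono power_increasing) auto
        then show ?thesis using 1 by (simp add: add_increasing)
      next
        case 2
        then show ?thesis using K[of k] by (simp add: mult_right_mono)
      next
        case 3
        then show ?thesis using \<beta>1 by (simp add: tree_walks_eq_0)
      qed
    qed
    then have "(\<Sum>k\<le>n. \<beta> ^ k * real (tree_walks q n k)) \<le> real (b n) + (\<Sum>k\<le>n. ?r k)"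
      unfolding b of_nat_sum of_nat_mult sum.distrib[symmetric] by (intro sum_mono)
    also have "(\<Sum>k\<le>n. ?r k) = (\<Sum>k\<in>{..n} \<inter> {..<K}. \<beta> ^ K * (2 * sqrt q) ^ n)"
      by (subst sum.inter_restrict) simp_all
    also have "\<dots> \<le> (\<Sum>k<K. \<beta> ^ K * (2 * sqrt q) ^ n)"
      using \<beta>1 by (intro sum_mono2) auto
    also have "\<dots> \<le> M * (2 * sqrt q) ^ n"
      by (simp add: M_def algebra_simps)
    finally show ?thesis
      using sum_tree_walks_ge[OF \<beta>1 q_less, of n] by (simp add: c_def)
  qed
  \<comment> \<open>One half of \<open>c * ?\<rho> ^ n\<close> beats \<open>\<rho> ^ n\<close>, the
    other half pays for the exceptional summands.\<close>
  have "\<forall>\<^sub>F n in sequentially. \<rho> ^ n < c / 2 * ?\<rho> ^ n"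
    using c \<rho> by (intro eventually_power_less') auto
  moreover have "\<forall>\<^sub>F n in sequentially. (2 * sqrt q) ^ n < c / (2 * M) * ?\<rho> ^ n"
    using c M two_sqrt_less[of \<beta> q] \<beta> \<beta>1 by (intro eventually_power_less') auto
  ultimately show ?thesis using eventually_gt_at_top[of 0]
  proof eventually_elim
    case (elim n)
    have "M * (2 * sqrt q) ^ n \<le> c / 2 * ?\<rho> ^ n" using elim(2) M by (simp add: field_simps)
    then show ?case using b_ge[of n] elim \<rho> by (auto simp: root_less_iff_power)
  qed
qed

text \<open>For upper limits \<open>a k\<close> may be large only at sparse \<open>k\<close>, so
  \<open>less_walk_root\<close> does not apply. Instead \<open>k\<close> is fixed and
  \<open>n\<close> is summed: the generating function of \<open>b\<close> converges at
  \<open>1 / (\<beta> + q / \<beta>)\<close> and dominates \<open>a k\<close> times the Green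
  function, which is at least \<open>1 / \<beta> ^ k\<close>.\<close>

lemma nb_count_le_of_walk_root_less:
  assumes \<beta>: "sqrt q < \<beta>" and \<rho>: "0 \<le> \<rho>" "\<rho> < \<beta> + q / \<beta>"
    and ev: "\<forall>\<^sub>F n in sequentially. root n (b n) < \<rho>"
  shows "\<exists>B. \<forall>k. real (a k) \<le> B * \<beta> ^ k"
proof -
  have \<beta>1: "1 \<le> \<beta>" using sqrt_q \<beta> by linarith
  define z where "z = 1 / (\<beta> + q / \<beta>)"
  have z: "0 < z" "\<rho> * z < 1" using \<rho> by (auto simp: z_def)
  have "\<forall>\<^sub>F n in sequentially. norm (real (b n) * z ^ n) \<le> (\<rho> * z) ^ n"
    using ev eventually_gt_at_top[of 0]
    by eventually_elim (use \<rho> z in \<open>auto simp: root_less_iff_power power_mult_distrib\<close>)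
  then have summ: "summable (\<lambda>n. real (b n) * z ^ n)"
    by (rule summable_comparison_test_ev) (use z \<rho> in \<open>auto intro: summable_geometric\<close>)
  have "real (a k) \<le> (\<Sum>n. real (b n) * z ^ n) * \<beta> ^ k" for k
  proof -
    note G = tree_green_ge[OF q \<beta>, of k, folded z_def]
    have "real (a k) * (1 / \<beta> ^ k) \<le> real (a k) * (\<Sum>n. real (tree_walks q n k) * z ^ n)"
      by (intro mult_left_mono G) auto
    also have "\<dots> = (\<Sum>n. real (a k) * (real (tree_walks q n k) * z ^ n))"
      by (intro suminf_mult[symmetric] G)
    also have "\<dots> \<le> (\<Sum>n. real (b n) * z ^ n)"
    proof (intro suminf_le summ summable_mult G)
      fix n
      have "real (a k * tree_walks q n k) \<le> real (b n)" using b_ge of_nat_le_iff by blast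
      then show "real (a k) * (real (tree_walks q n k) * z ^ n) \<le> real (b n) * z ^ n"
        using z by (simp add: mult_right_mono flip: mult.assoc)
    qed
    finally show ?thesis using \<beta>1 by (simp add: field_simps)
  qed
  then show ?thesis by blast
qed

lemma walk_root_less_g:
  assumes "\<And>n k. J n \<Longrightarrow> even (n + k) \<Longrightarrow> J k"
    and "\<And>\<beta>. \<alpha> < \<beta> \<Longrightarrow> \<forall>\<^sub>F k in sequentially. J k \<longrightarrow> root k (a k) < \<beta>"
    and "g (Suc q) \<alpha> < \<rho>"
  shows "\<forall>\<^sub>F n in sequentially. J n \<longrightarrow> root n (b n) < \<rho>"
proof -
  obtain \<beta> where "max \<alpha> (sqrt q) < \<beta>" "\<beta> + q / \<beta> < \<rho>"
    using ex_greater_add_divide_less[of "max \<alpha> (sqrt q)" q \<rho>] assms(3) max_sqrt_q_pos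
    unfolding g_Suc by auto
  then show ?thesis using assms(1,2) by (intro walk_root_less[of J \<beta>]) auto
qed

lemma g_less_walk_root:
  assumes "0 < a k" "even (k + e)"
    and a: "\<And>\<beta>. \<beta> < \<alpha> \<Longrightarrow> \<forall>\<^sub>F k in sequentially. even (k + e) \<longrightarrow> \<beta> < root k (a k)"
    and \<rho>: "0 \<le> \<rho>" "\<rho> < g (Suc q) \<alpha>"
  shows "\<forall>\<^sub>F n in sequentially. even (n + e) \<longrightarrow> \<rho> < root n (b n)"
proof (cases "\<alpha> \<le> sqrt q")
  case True
  have "even (n + k) \<longleftrightarrow> even (n + e)" for n using assms(2) by auto
  then show ?thesis
    using less_walk_root_base[of k \<rho>] assms True by (simp add: g_def)
next
  case False
  then obtain \<beta> where "sqrt q < \<beta>" "\<beta> < \<alpha>" "\<rho> < \<beta> + q / \<beta>"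
    using ex_between_less_add_divide[of "sqrt q" \<alpha> \<rho> q] \<rho> by (auto simp: g_def)
  then show ?thesis using less_walk_root a \<rho> by blast
qed

lemma walk_root_limit:
  assumes e: "e \<le> 1" and "0 < a k" "even (k + e)"
    and lim: "(\<lambda>t. root (2 * t + e) (a (2 * t + e))) \<longlonglongrightarrow> \<alpha>"
  shows "(\<lambda>t. root (2 * t + e) (b (2 * t + e))) \<longlonglongrightarrow> g (Suc q) \<alpha>"
proof (rule order_tendstoI)
  fix \<rho> assume \<rho>: "\<rho> < g (Suc q) \<alpha>"
  have "\<forall>\<^sub>F k in sequentially. even (k + e) \<longrightarrow> \<beta> < root k (a k)" if "\<beta> < \<alpha>" for \<beta>
    using order_tendstoD(1)[OF lim that] eventually_parity_iff[OF e, of "\<lambda>k. \<beta> < root k (a k)"]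
    by blast
  \<comment> \<open>Comparing roots with powers requires a nonnegative bound; \<open>g_pos\<close>
    keeps \<open>max \<rho> 0\<close> below the target.\<close>
  then have "\<forall>\<^sub>F n in sequentially. even (n + e) \<longrightarrow> max \<rho> 0 < root n (b n)"
    using assms(2,3) \<rho> g_pos by (intro g_less_walk_root[of k e \<alpha>]) auto
  then have "\<forall>\<^sub>F t in sequentially. max \<rho> 0 < root (2 * t + e) (b (2 * t + e))"
    using eventually_parity_iff[OF e, of "\<lambda>n. max \<rho> 0 < root n (b n)"] by blast
  then show "\<forall>\<^sub>F t in sequentially. \<rho> < root (2 * t + e) (b (2 * t + e))"
    by eventually_elim simp
next
  fix \<rho> assume \<rho>: "g (Suc q) \<alpha> < \<rho>"
  have "\<forall>\<^sub>F k in sequentially. even (k + e) \<longrightarrow> root k (a k) < \<beta>" if "\<alpha> < \<beta>" for \<beta>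
    using order_tendstoD(2)[OF lim that] eventually_parity_iff[OF e, of "\<lambda>k. root k (a k) < \<beta>"]
    by blast
  then have "\<forall>\<^sub>F n in sequentially. even (n + e) \<longrightarrow> root n (b n) < \<rho>"
    using \<rho> by (intro walk_root_less_g[where J = "\<lambda>n. even (n + e)" and \<alpha> = \<alpha>]) auto
  then show "\<forall>\<^sub>F t in sequentially. root (2 * t + e) (b (2 * t + e)) < \<rho>"
    using eventually_parity_iff[OF e, of "\<lambda>n. root n (b n) < \<rho>"] by blast
qed

text \<open>The upper bound runs as for ordinary limits, with all indices in \<open>J\<close>. The
  lower bound is by contradiction: for small \<open>\<alpha>\<close> a single vertex of
  \<open>S\<close> is enough, for large \<open>\<alpha>\<close> too small a \<open>b\<close> would
  bound \<open>a\<close> by a rate below \<open>\<alpha>\<close>.\<close>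

lemma walk_root_limsup:
  assumes "0 < a k"
    and lim: "limsup (\<lambda>t. ereal (root t (a t))) = ereal \<alpha>"
  shows "limsup (\<lambda>t. ereal (root t (b t))) = ereal (g (Suc q) \<alpha>)"
proof (rule antisym)
  show "limsup (\<lambda>t. ereal (root t (b t))) \<le> ereal (g (Suc q) \<alpha>)"
    unfolding Limsup_le_iff
  proof (intro allI impI)
    fix y assume y: "ereal (g (Suc q) \<alpha>) < y"
    show "\<forall>\<^sub>F t in sequentially. ereal (root t (b t)) < y"
    proof (cases y)
      case (real \<rho>)
      have "\<forall>\<^sub>F k in sequentially. root k (a k) < \<beta>" if "\<alpha> < \<beta>" for \<beta>
        using Limsup_lessD[of sequentially "\<lambda>t. ereal (root t (a t))" "ereal \<beta>"] that
        unfolding lim by simp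
      then have "\<forall>\<^sub>F n in sequentially. True \<longrightarrow> root n (b n) < \<rho>"
        by (intro walk_root_less_g[of "\<lambda>_. True" \<alpha>]) (use y real in auto)
      then show ?thesis using real by simp
    qed (use y in auto)
  qed
  show "ereal (g (Suc q) \<alpha>) \<le> limsup (\<lambda>t. ereal (root t (b t)))"
  proof (rule ccontr)
    assume "\<not> ?thesis"
    then obtain y where y: "limsup (\<lambda>t. ereal (root t (b t))) < ereal y" "y < g (Suc q) \<alpha>"
      by (metis ereal_dense2 ereal_less_eq(3) not_le)
    define \<rho> where "\<rho> = max y 0"
    have \<rho>: "0 \<le> \<rho>" "\<rho> < g (Suc q) \<alpha>" using y g_pos by (auto simp: \<rho>_def)
    have ev: "\<forall>\<^sub>F t in sequentially. root t (b t) < \<rho>"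
      using Limsup_lessD[OF y(1)] by eventually_elim (simp add: \<rho>_def)
    show False
    proof (cases "\<alpha> \<le> sqrt q")
      case True
      then have "\<forall>\<^sub>F n in sequentially. even (n + k) \<longrightarrow> \<rho> < root n (b n)"
        using less_walk_root_base[OF assms(1)] \<rho> by (simp add: g_def)
      \<comment> \<open>Both bounds on \<open>root n (b n)\<close> would hold at large
        \<open>n\<close> of the parity of \<open>k\<close>, so no such \<open>n\<close> may
        exist.\<close>
      with ev have "\<forall>\<^sub>F n in sequentially. odd (n + k)" by eventually_elim auto
      then obtain N where "\<And>n. N \<le> n \<Longrightarrow> odd (n + k)" by (auto simp: eventually_sequentially)
      from this[of N] this[of "Suc N"] show False by simp
    next
      case False
      then obtain \<beta> where \<beta>: "sqrt q < \<beta>" "\<beta> < \<alpha>" "\<rho> < \<beta> + q / \<beta>"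
        using ex_between_less_add_divide[of "sqrt q" \<alpha> \<rho> q] \<rho> by (auto simp: g_def)
      obtain B where B: "\<And>k. real (a k) \<le> B * \<beta> ^ k"
        using nb_count_le_of_walk_root_less[OF \<beta>(1) \<rho>(1) \<beta>(3) ev] by blast
      have "0 \<le> B" using B[of 0] of_nat_0_le_iff[of "a 0"] by simp
      \<comment> \<open>A rate strictly between \<open>\<beta>\<close> and \<open>\<alpha>\<close>
        absorbs the factor \<open>B\<close>; the \<open>B + 1\<close> below avoids division by
        zero.\<close>
      obtain \<gamma> where \<gamma>: "\<beta> < \<gamma>" "\<gamma> < \<alpha>" using dense[OF \<beta>(2)] by auto
      have \<beta>0: "0 \<le> \<beta>" using sqrt_q \<beta> by linarith
      have "\<forall>\<^sub>F n in sequentially. \<beta> ^ n < 1 / (B + 1) * \<gamma> ^ n"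
        using \<gamma> \<beta>0 \<open>0 \<le> B\<close> by (intro eventually_power_less') auto
      then have "\<forall>\<^sub>F n in sequentially. ereal (root n (a n)) \<le> ereal \<gamma>"
        using eventually_gt_at_top[of 0]
      proof eventually_elim
        case (elim n)
        have "B * \<beta> ^ n \<le> (B + 1) * \<beta> ^ n" using \<beta>0 by (intro mult_right_mono) auto
        also have "\<dots> < \<gamma> ^ n" using elim \<open>0 \<le> B\<close> by (simp add: field_simps)
        finally have "real (a n) < \<gamma> ^ n" using B[of n] by simp
        then show ?case using elim \<gamma> \<beta>0 root_less_iff_power(1)[of n \<gamma> "a n"] by simp
      qed
      then have "ereal \<alpha> \<le> ereal \<gamma>" unfolding lim[symmetric] by (rule Limsup_bounded)
      then show False using \<gamma> by simp
    qed
  qed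
qed

end

section \<open>Distances and walks in a regular tree\<close>

lemma walk_Cons: "walk V E (x # p) \<longleftrightarrow> x \<in> V \<and> (p = [] \<or> (x, hd p) \<in> E \<and> walk V E p)"
  by (auto simp: walk_def successively_Cons)

lemma walk_snoc: "walk V E (p @ [x]) \<longleftrightarrow> x \<in> V \<and> (p = [] \<or> (last p, x) \<in> E \<and> walk V E p)"
  by (auto simp: walk_def successively_append_iff)

lemma nonbacktracking_appendD:
  assumes "nonbacktracking (p @ p')"
  shows "nonbacktracking p"
  unfolding nonbacktracking_def
proof (intro allI impI)
  fix i assume "i + 2 < length p"
  then show "p ! i \<noteq> p ! (i + 2)"
    using assms[unfolded nonbacktracking_def, rule_format, of i] by (simp add: nth_append)
qed

lemma nonbacktracking_snoc:
  "nonbacktracking (p @ [x, y, z]) \<longleftrightarrow> nonbacktracking (p @ [x, y]) \<and> x \<noteq> z"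
proof -
  have nth: "(p @ [x, y, z]) ! i = (p @ [x, y]) ! i" if "i < length p + 2" for i
    using nth_append[of "p @ [x, y]" "[z]" i] that by simp
  have "{i. i + 2 < length (p @ [x, y, z])} =
      insert (length p) {i. i + 2 < length (p @ [x, y])}" by auto
  then have "nonbacktracking (p @ [x, y, z]) \<longleftrightarrow>
      (\<forall>i\<in>insert (length p) {i. i + 2 < length (p @ [x, y])}.
        (p @ [x, y, z]) ! i \<noteq> (p @ [x, y, z]) ! (i + 2))"
    unfolding nonbacktracking_def by blast
  also have "\<dots> \<longleftrightarrow> x \<noteq> z \<and> (\<forall>i\<in>{i. i + 2 < length (p @ [x, y])}.
      (p @ [x, y, z]) ! i \<noteq> (p @ [x, y, z]) ! (i + 2))"
    by (simp add: nth_append)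
  also have "\<dots> \<longleftrightarrow> x \<noteq> z \<and> (\<forall>i\<in>{i. i + 2 < length (p @ [x, y])}.
      (p @ [x, y]) ! i \<noteq> (p @ [x, y]) ! (i + 2))"
    using nth by (intro arg_cong2[of _ _ _ _ "(\<and>)"] refl ball_cong) auto
  finally show ?thesis unfolding nonbacktracking_def by blast
qed

locale rooted_regular_tree = regular_tree V E d for V :: "'a set" and E d +
  fixes r :: 'a and q :: nat
  assumes root_in: "r \<in> V" and d: "d = Suc q"
begin

abbreviation depth :: "'a \<Rightarrow> nat" where
  "depth v \<equiv> graph_dist V E r v"

abbreviation walks_to :: "nat \<Rightarrow> 'a \<Rightarrow> 'a list set" where
  "walks_to n v \<equiv> walks_into V E r {v} n"

lemma edgeD: "(u, v) \<in> E \<Longrightarrow> u \<in> V \<and> v \<in> V \<and> u \<noteq> v \<and> (v, u) \<in> E"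
  using edges_subset sym_edges irrefl_edges by (auto simp: sym_def irrefl_def)

lemma depth_le: "walk V E p \<Longrightarrow> hd p = r \<Longrightarrow> depth (last p) \<le> length p - 1"
  unfolding graph_dist_def
  by (rule Least_le) (auto simp: walk_def intro!: exI[of _ p])

lemma depth_walk:
  assumes "v \<in> V"
  obtains p where "walk V E p" "length p = Suc (depth v)" "hd p = r" "last p = v"
proof -
  obtain p where "walk V E p" "hd p = r" "last p = v" using connected[OF root_in assms] by blast
  then have "\<exists>p'. walk V E p' \<and> length p' = Suc (length p - 1) \<and> hd p' = r \<and> last p' = v"
    by (auto simp: walk_def intro!: exI[of _ p])
  from LeastI[of "\<lambda>n. \<exists>p. walk V E p \<and> length p = Suc n \<and> hd p = r \<and> last p = v", OF this]
  show ?thesis using that unfolding graph_dist_def by blast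
qed

lemma depth_root: "depth r = 0"
  using depth_le[of "[r]"] root_in by (simp add: walk_def)

lemma depth_0_iff: "v \<in> V \<Longrightarrow> depth v = 0 \<longleftrightarrow> v = r"
  by (metis depth_root depth_walk length_0_conv length_Suc_conv list.sel(1) last_ConsL)

lemma depth_edge_le: "(u, v) \<in> E \<Longrightarrow> depth v \<le> Suc (depth u)"
proof -
  assume uv: "(u, v) \<in> E"
  obtain p where p: "walk V E p" "length p = Suc (depth u)" "hd p = r" "last p = u"
    using depth_walk edgeD[OF uv] by blast
  have "p \<noteq> []" using p(2) by auto
  then show ?thesis using depth_le[of "p @ [v]"] p uv edgeD[OF uv] by (simp add: walk_snoc)
qed

lemma parent_exists:
  assumes "v \<in> V" "depth v = Suc n"
  obtains u where "(u, v) \<in> E" "depth u = n"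
proof -
  obtain p where p: "walk V E p" "length p = Suc (Suc n)" "hd p = r" "last p = v"
    using depth_walk assms by metis
  obtain p' where p': "p = p' @ [v]" using p by (metis append_butlast_last_id length_0_conv nat.distinct(1))
  have "p' \<noteq> []" using p p' by auto
  then have "(last p', v) \<in> E" "depth (last p') \<le> n"
    using p p' depth_le[of p'] by (auto simp: walk_snoc)
  then show ?thesis using that[of "last p'"] depth_edge_le[of "last p'" v] assms by simp
qed

text \<open>Two vertices at equal depth are joined by climbing to their nearest common ancestor.\<close>

lemma path_below:
  assumes "u \<in> V" "w \<in> V" "u \<noteq> w" "depth u = n" "depth w = n"
  shows "\<exists>p. walk V E p \<and> distinct p \<and> hd p = u \<and> last p = w \<and> 3 \<le> length p \<and>
    (\<forall>x\<in>set p. x = u \<or> x = w \<or> depth x < n)"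
  using assms
proof (induction n arbitrary: u w)
  case 0
  then show ?case by (metis depth_0_iff)
next
  case (Suc n)
  obtain u' where u': "(u', u) \<in> E" "depth u' = n" using parent_exists Suc.prems by metis
  obtain w' where w': "(w', w) \<in> E" "depth w' = n" using parent_exists Suc.prems by metis
  show ?case
  proof (cases "u' = w'")
    case True
    then show ?thesis using u' w' Suc.prems edgeD[OF u'(1)] edgeD[OF w'(1)]
      by (intro exI[of _ "[u, u', w]"]) (auto simp: walk_Cons)
  next
    case False
    then obtain p where p: "walk V E p" "distinct p" "hd p = u'" "last p = w'" "3 \<le> length p"
      "\<And>x. x \<in> set p \<Longrightarrow> x = u' \<or> x = w' \<or> depth x < n"
      using Suc.IH[of u' w'] u' w' edgeD by metis
    \<comment> \<open>The path found between the parents stays at depth at most \<open>n\<close>, so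
      attaching \<open>u\<close> and \<open>w\<close> keeps it distinct.\<close>
    have low: "depth x \<le> n" if "x \<in> set p" for x using p(6)[OF that] u' w' by auto
    have "p \<noteq> []" using p(5) by auto
    moreover have "u \<notin> set p" "w \<notin> set p" using low[of u] low[of w] Suc.prems by auto
    ultimately show ?thesis using p u' w' Suc.prems low edgeD[OF u'(1)] edgeD[OF w'(1)]
      by (intro exI[of _ "u # p @ [w]"])
         (auto simp: walk_Cons walk_snoc simp flip: append_Cons intro: le_imp_less_Suc)
  qed
qed

text \<open>An edge inside a level would close the path of \<open>path_below\<close> to a
  cycle.\<close>

lemma depth_edge_neq: "(u, v) \<in> E \<Longrightarrow> depth u \<noteq> depth v"
proof
  assume uv: "(u, v) \<in> E" and eq: "depth u = depth v"
  then obtain p where "walk V E p" "distinct p" "hd p = u" "last p = v" "3 \<le> length p"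
    using path_below[OF _ _ _ eq refl] edgeD[OF uv] by blast
  then have "is_cycle V E p" using edgeD[OF uv] by (simp add: is_cycle_def)
  then show False using no_cycle by blast
qed

text \<open>Two distinct parents are joined by a path no deeper than themselves. It avoids the
  deeper vertex \<open>v\<close>, and adding \<open>v\<close> gives a cycle.\<close>

lemma parent_unique:
  assumes "(u, v) \<in> E" "(w, v) \<in> E" "depth v = Suc (depth u)" "depth w = depth u"
  shows "u = w"
proof (rule ccontr)
  assume "u \<noteq> w"
  then obtain p where p: "walk V E p" "distinct p" "hd p = u" "last p = w" "3 \<le> length p"
    "\<And>x. x \<in> set p \<Longrightarrow> x = u \<or> x = w \<or> depth x < depth u"
    using path_below[of u w "depth u"] assms edgeD by metis
  have "v \<notin> set p" using p(6)[of v] assms edgeD[OF assms(1)] edgeD[OF assms(2)] by auto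
  moreover have "p \<noteq> []" using p(5) by auto
  ultimately have "is_cycle V E (v # p)"
    using p assms edgeD[OF assms(1)] by (auto simp: is_cycle_def walk_Cons)
  then show False using no_cycle by blast
qed

lemma depth_edge_cases:
  assumes "(u, v) \<in> E"
  shows "depth v = Suc (depth u) \<or> depth u = Suc (depth v)"
  using depth_edge_le[OF assms] depth_edge_le[of v u] depth_edge_neq[OF assms] edgeD[OF assms]
  by auto

text \<open>A crude bound, enough for finiteness and for bounding the roots of the non-backtracking
  counts.\<close>

lemma sphere: "finite {v \<in> V. depth v = n} \<and> card {v \<in> V. depth v = n} \<le> d ^ n"
proof (induction n)
  case 0
  have "{v \<in> V. depth v = 0} = {r}" using depth_0_iff depth_root root_in by auto
  then show ?case by simp
next
  case (Suc n)
  let ?S = "{v \<in> V. depth v = n}"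
  have sub: "{v \<in> V. depth v = Suc n} \<subseteq> (\<Union>u\<in>?S. {w. (u, w) \<in> E})"
  proof
    fix v assume v: "v \<in> {v \<in> V. depth v = Suc n}"
    then obtain u where "(u, v) \<in> E" "depth u = n" using parent_exists[of v n] by blast
    then show "v \<in> (\<Union>u\<in>?S. {w. (u, w) \<in> E})" using edgeD[of u v] by blast
  qed
  have fin: "finite (\<Union>u\<in>?S. {w. (u, w) \<in> E})" using Suc finite_neighbours by auto
  have "card {v \<in> V. depth v = Suc n} \<le> card (\<Union>u\<in>?S. {w. (u, w) \<in> E})"
    using sub fin by (rule card_mono[rotated])
  also have "\<dots> \<le> (\<Sum>u\<in>?S. card {w. (u, w) \<in> E})" using Suc by (intro card_UN_le) auto
  also have "\<dots> = card ?S * d" using regular by simp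
  also have "\<dots> \<le> d ^ Suc n" using Suc by simp
  finally show ?case using finite_subset[OF sub fin] by simp
qed

lemma walks_to_Suc:
  assumes "v \<in> V"
  shows "walks_to (Suc n) v = (\<Union>u\<in>{u. (v, u) \<in> E}. (\<lambda>p. p @ [v]) ` walks_to n u)"
proof (intro set_eqI iffI)
  fix p assume p: "p \<in> walks_to (Suc n) v"
  then obtain p' where p': "p = p' @ [v]"
    by (auto simp: walks_into_def) (metis append_butlast_last_id length_0_conv nat.distinct(1))
  then have "p' \<noteq> []" using p by (auto simp: walks_into_def)
  then have "p' \<in> walks_to n (last p')" "(v, last p') \<in> E"
    using p p' by (auto simp: walks_into_def walk_snoc dest: edgeD)
  then show "p \<in> (\<Union>u\<in>{u. (v, u) \<in> E}. (\<lambda>p. p @ [v]) ` walks_to n u)" using p' by blast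
next
  fix p assume "p \<in> (\<Union>u\<in>{u. (v, u) \<in> E}. (\<lambda>p. p @ [v]) ` walks_to n u)"
  then show "p \<in> walks_to (Suc n) v"
    using assms by (auto simp: walks_into_def walk_snoc hd_append dest: edgeD)
qed

text \<open>A vertex other than the root has exactly one parent, and its other \<open>q\<close>
  neighbours lie one level deeper; all \<open>Suc q\<close> neighbours of the root have depth
  1.\<close>

lemma neighbours_sum:
  assumes v: "v \<in> V" and f: "\<And>u. (v, u) \<in> E \<Longrightarrow> f u = h (depth u)"
  shows "(\<Sum>u\<in>{u. (v, u) \<in> E}. f u) =
    (case depth v of 0 \<Rightarrow> Suc q * h 1 | Suc k \<Rightarrow> h k + q * h (Suc (Suc k)))"
proof (cases "depth v")
  case 0
  have "f u = h 1" if "(v, u) \<in> E" for u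
    using f[OF that] depth_edge_cases[OF that] 0 by simp
  then show ?thesis using 0 v regular[OF v] d by simp
next
  case (Suc k)
  let ?A = "{u. (v, u) \<in> E}"
  obtain w where w: "(w, v) \<in> E" "depth w = k" using parent_exists[OF v Suc] by blast
  have fin: "finite ?A" using finite_neighbours v by blast
  have wA: "w \<in> ?A" using w edgeD by blast
  have up: "f u = h (Suc (Suc k))" if "u \<in> ?A - {w}" for u
  proof -
    have "depth u \<noteq> k" using parent_unique[of w v u] w that Suc edgeD by auto
    then show ?thesis using f[of u] that depth_edge_cases[of v u] Suc by auto
  qed
  have "sum f ?A = f w + sum f (?A - {w})" using fin wA by (rule sum.remove)
  also have "sum f (?A - {w}) = q * h (Suc (Suc k))"
    using up fin wA regular[OF v] d by simp
  finally show ?thesis using Suc f[of w] wA w by simp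
qed

text \<open>Splitting off the last step turns \<open>neighbours_sum\<close> into the recursion of
  \<open>tree_walks\<close>.\<close>

lemma card_walks_to:
  "v \<in> V \<Longrightarrow> finite (walks_to n v) \<and> card (walks_to n v) = tree_walks q n (depth v)"
proof (induction n arbitrary: v)
  case 0
  have "walks_to 0 v = (if v = r then {[r]} else {})"
    using root_in by (auto simp: walks_into_def walk_def length_Suc_conv)
  then show ?case using 0 by (simp add: depth_0_iff)
next
  case (Suc n)
  let ?A = "{u. (v, u) \<in> E}"
  have fin: "finite ?A" using finite_neighbours Suc.prems by blast
  have IH: "finite (walks_to n u) \<and> card (walks_to n u) = tree_walks q n (depth u)"
    if "(v, u) \<in> E" for u using Suc.IH[of u] edgeD[OF that] by blast
  have "card (walks_to (Suc n) v) = (\<Sum>u\<in>?A. card ((\<lambda>p. p @ [v]) ` walks_to n u))"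
    unfolding walks_to_Suc[OF Suc.prems]
    using fin IH by (intro card_UN_disjoint) (auto simp: walks_into_def)
  also have "\<dots> = (\<Sum>u\<in>?A. card (walks_to n u))"
    by (intro sum.cong refl card_image) (auto simp: inj_on_def)
  also have "\<dots> = (case depth v of 0 \<Rightarrow> Suc q * tree_walks q n 1
      | Suc k \<Rightarrow> tree_walks q n k + q * tree_walks q n (Suc (Suc k)))"
    using neighbours_sum[OF Suc.prems, of "\<lambda>u. card (walks_to n u)" "tree_walks q n"] IH by blast
  also have "\<dots> = tree_walks q (Suc n) (depth v)" by (cases "depth v") auto
  finally show ?case unfolding walks_to_Suc[OF Suc.prems] using fin IH by auto
qed

text \<open>Such a walk descends at every step: a step upwards would lead to the unique parent,
  which is the vertex two places earlier. The induction is strong because the depths of two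
  preceding vertices are used.\<close>

lemma nb_walk_depth:
  assumes "walk V E p" "hd p = r" "nonbacktracking p" "p \<noteq> []"
  shows "depth (last p) = length p - 1"
  using assms
proof (induction "length p" arbitrary: p rule: less_induct)
  case less
  consider x where "p = [x]" | x y where "p = [x, y]" | p' x y z where "p = p' @ [x, y, z]"
    using less.prems(4) by (metis append.assoc append_Cons append_Nil rev_exhaust)
  then show ?case
  proof cases
    case 1
    then show ?thesis using less.prems depth_root by simp
  next
    case 2
    then show ?thesis using less.prems depth_root depth_edge_cases[of x y] by (simp add: walk_Cons)
  next
    case 3
    have w: "walk V E (p' @ [x])" "walk V E (p' @ [x, y])" "(x, y) \<in> E" "(y, z) \<in> E"
      using less.prems(1) 3 walk_snoc[of V E "p' @ [x, y]" z] walk_snoc[of V E "p' @ [x]" y] by auto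
    have nb: "nonbacktracking (p' @ [x, y])" "x \<noteq> z"
      using less.prems(3) 3 nonbacktracking_snoc[of p' x y z] by auto
    have nb': "nonbacktracking (p' @ [x])"
      using nb(1) nonbacktracking_appendD[of "p' @ [x]" "[y]"] by simp
    have hd: "hd (p' @ [x]) = r" "hd (p' @ [x, y]) = r"
      using less.prems(2) 3 by (auto simp: hd_append)
    have "depth y = Suc (length p')" "depth x = length p'"
      using less.hyps[of "p' @ [x, y]"] less.hyps[of "p' @ [x]"] w nb nb' hd 3 by auto
    moreover have "depth z \<noteq> depth x"
      using parent_unique[of x y z] w nb(2) edgeD[OF w(4)] calculation by auto
    ultimately show ?thesis using depth_edge_cases[OF w(4)] 3 by auto
  qed
qed

text \<open>The vertex at position \<open>i\<close> of a geodesic has depth \<open>i\<close>, so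
  vertices two places apart differ.\<close>

lemma geodesic_nonbacktracking:
  assumes "walk V E p" "hd p = r" "length p = Suc (depth (last p))"
  shows "nonbacktracking p"
  unfolding nonbacktracking_def
proof (intro allI impI)
  fix i assume i: "i + 2 < length p"
  \<comment> \<open>The induction runs backwards from the last vertex, whose depth is known.
    Prefixes of \<open>p\<close> bound the depth from above, and one edge changes it by at most
    1.\<close>
  have "depth (p ! (length p - 1 - j)) = length p - 1 - j" if "j < length p" for j
    using that
  proof (induction j)
    case 0
    have "p ! (length p - 1) = last p" using assms(3) by (intro last_conv_nth[symmetric]) auto
    then show ?case using assms(3) by simp
  next
    case (Suc j)
    let ?i = "length p - 1 - Suc j"
    have "length p - 1 - j = Suc ?i" using Suc.prems by auto
    have "walk V E (take (Suc ?i) p)"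
      using assms(1) by (auto simp: walk_def successively_conv_nth dest: in_set_takeD)
    moreover have "hd (take (Suc ?i) p) = r" using assms(2) by (simp add: hd_take)
    moreover have "last (take (Suc ?i) p) = p ! ?i"
      using Suc.prems by (simp add: take_Suc_conv_app_nth)
    ultimately have "depth (p ! ?i) \<le> ?i"
      using depth_le[of "take (Suc ?i) p"] by simp
    moreover have "(p ! ?i, p ! Suc ?i) \<in> E"
      using assms(1) Suc.prems by (auto simp: walk_def successively_conv_nth)
    then have "depth (p ! Suc ?i) \<le> Suc (depth (p ! ?i))" by (rule depth_edge_le)
    ultimately show ?case using Suc unfolding \<open>length p - 1 - j = Suc ?i\<close> by simp
  qed
  from this[of "length p - 1 - i"] this[of "length p - 1 - (i + 2)"] i
  have "depth (p ! i) = i" "depth (p ! (i + 2)) = i + 2" by auto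
  then show "p ! i \<noteq> p ! (i + 2)" by auto
qed

text \<open>Going back from the common end, the predecessors are parents of the same vertex and
  agree by \<open>parent_unique\<close>.\<close>

lemma geodesic_unique:
  assumes "walk V E p" "hd p = r" "length p = Suc (depth (last p))"
    and "walk V E p'" "hd p' = r" "length p' = Suc (depth (last p'))"
    and "last p = last p'"
  shows "p = p'"
  using assms
proof (induction p arbitrary: p' rule: rev_induct)
  case Nil
  then show ?case by simp
next
  case (snoc x p)
  obtain s where s: "p' = s @ [x]"
    using snoc.prems by (metis append_butlast_last_id last_snoc length_0_conv nat.distinct(1))
  show ?case
  proof (cases "p = []")
    case True
    then show ?thesis using snoc.prems s by simp
  next
    case False
    then have "s \<noteq> []" using snoc.prems s by auto
    have p: "walk V E p" "(last p, x) \<in> E" "hd p = r" using snoc.prems(1,2) False by (auto simp: walk_snoc)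
    have s': "walk V E s" "(last s, x) \<in> E" "hd s = r" using snoc.prems(4,5) s \<open>s \<noteq> []\<close> by (auto simp: walk_snoc)
    have len: "length p = depth x" "length s = depth x" using snoc.prems s by auto
    have "Suc (depth (last p)) = depth x" "Suc (depth (last s)) = depth x"
      using depth_le[OF p(1,3)] depth_le[OF s'(1,3)] depth_edge_le[OF p(2)] depth_edge_le[OF s'(2)]
        len False \<open>s \<noteq> []\<close> by (auto simp: Suc_le_eq neq_Nil_conv)
    moreover from this have "last p = last s"
      using parent_unique[of "last p" x "last s"] p s' by simp
    ultimately have "p = s" using snoc.IH[of s] p s' len by simp
    then show ?thesis using s by simp
  qed
qed

section \<open>Walk counts into a vertex set\<close>

context
  fixes S :: "'a set"
  assumes S: "S \<subseteq> V"
begin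

text \<open>Non-backtracking walks from the root are exactly the geodesics, so \<open>last\<close>
  is a bijection by their existence and uniqueness.\<close>

lemma nb_walk_count_eq: "nb_walk_count V E r S n = card {v \<in> S. depth v = n}"
proof -
  let ?W = "{p \<in> walks_into V E r S n. nonbacktracking p}"
  have dep: "depth (last p) = n" if "p \<in> ?W" for p
    using that nb_walk_depth[of p] by (cases "p = []") (auto simp: walks_into_def)
  have "inj_on last ?W"
    using dep geodesic_unique by (auto simp: inj_on_def walks_into_def)
  moreover have "last ` ?W = {v \<in> S. depth v = n}"
  proof (intro equalityI subsetI)
    fix v assume "v \<in> last ` ?W"
    then show "v \<in> {v \<in> S. depth v = n}" using dep by (auto simp: walks_into_def)
  next
    fix v assume v: "v \<in> {v \<in> S. depth v = n}"
    then obtain p where p: "walk V E p" "length p = Suc (depth v)" "hd p = r" "last p = v"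
      using depth_walk S by blast
    then have "p \<in> ?W" using geodesic_nonbacktracking v by (auto simp: walks_into_def)
    then show "v \<in> last ` ?W" using p by blast
  qed
  ultimately show ?thesis unfolding nb_walk_count_def using card_image[of last ?W] by argo
qed

lemma nb_walk_count_le: "nb_walk_count V E r S n \<le> d ^ n"
  unfolding nb_walk_count_eq
  by (rule order_trans[OF card_mono[of "{v \<in> V. depth v = n}"]]) (use S sphere[of n] in auto)

text \<open>Walks are sorted by endpoint. Its depth is at most \<open>n\<close>, and by
  \<open>card_walks_to\<close> the number of walks depends on that depth alone.\<close>

lemma walk_count_eq: "walk_count V E r S n = (\<Sum>k\<le>n. nb_walk_count V E r S k * tree_walks q n k)"
proof -
  let ?S = "\<lambda>k. {v \<in> S. depth v = k}"
  have fin: "finite (?S k)" for k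
    using S sphere[of k] by (auto intro: finite_subset[of _ "{v \<in> V. depth v = k}"])
  have "walks_into V E r S n = (\<Union>v\<in>(\<Union>k\<le>n. ?S k). walks_to n v)"
  proof (intro equalityI subsetI)
    fix p assume p: "p \<in> walks_into V E r S n"
    then have "depth (last p) \<le> n" using depth_le[of p] by (auto simp: walks_into_def)
    then show "p \<in> (\<Union>v\<in>(\<Union>k\<le>n. ?S k). walks_to n v)" using p by (auto simp: walks_into_def)
  qed (auto simp: walks_into_def)
  then have "walk_count V E r S n = card (\<Union>v\<in>(\<Union>k\<le>n. ?S k). walks_to n v)"
    by (simp add: walk_count_def)
  also have "\<dots> = (\<Sum>v\<in>(\<Union>k\<le>n. ?S k). card (walks_to n v))"
    using fin S card_walks_to by (intro card_UN_disjoint) (auto simp: walks_into_def)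
  also have "\<dots> = (\<Sum>k\<le>n. \<Sum>v\<in>?S k. card (walks_to n v))"
    using fin by (intro sum.UNION_disjoint) auto
  also have "\<dots> = (\<Sum>k\<le>n. card (?S k) * tree_walks q n k)"
    using S card_walks_to by (intro sum.cong refl) (auto simp: subset_iff)
  finally show ?thesis by (simp add: nb_walk_count_eq)
qed

lemma nb_walk_count_pos: "v \<in> S \<Longrightarrow> 0 < nb_walk_count V E r S (depth v)"
  unfolding nb_walk_count_eq
  using S sphere[of "depth v"] finite_subset[of "{u \<in> S. depth u = depth v}" "{u \<in> V. depth u = depth v}"]
  by (auto simp: card_gt_0_iff)

end

end

section \<open>Assembly of the upper and ordinary limits\<close>

theorem theorem1p2:
  fixes V :: "'a set" and E :: "('a \<times> 'a) set" and d :: nat and r :: 'a and S :: "'a set"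
  assumes "d \<ge> 3"
    and "regular_tree V E d"
    and "r \<in> V"
    and "S \<subseteq> V" and "S \<noteq> {}"
  shows
    "(\<exists>\<alpha>\<ge>0. limsup (\<lambda>t. ereal (root t (real (nb_walk_count V E r S t)))) = ereal \<alpha> \<and>
             limsup (\<lambda>t. ereal (root t (real (walk_count V E r S t)))) = ereal (g d \<alpha>)) \<and>
     (\<forall>\<alpha>. (\<lambda>t. root t (real (nb_walk_count V E r S t))) \<longlonglongrightarrow> \<alpha> \<and>
           even_part V E r S \<noteq> {} \<and> odd_part V E r S \<noteq> {} \<longrightarrow>
           (\<lambda>t. root t (real (walk_count V E r S t))) \<longlonglongrightarrow> g d \<alpha>) \<and>
     (\<forall>\<alpha>. (\<lambda>t. root (2 * t) (real (nb_walk_count V E r S (2 * t)))) \<longlonglongrightarrow> \<alpha> \<and>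
           even_part V E r S \<noteq> {} \<longrightarrow>
           (\<lambda>t. root (2 * t) (real (walk_count V E r S (2 * t)))) \<longlonglongrightarrow> g d \<alpha>) \<and>
     (\<forall>\<alpha>. (\<lambda>t. root (2 * t + 1) (real (nb_walk_count V E r S (2 * t + 1)))) \<longlonglongrightarrow> \<alpha> \<and>
           odd_part V E r S \<noteq> {} \<longrightarrow>
           (\<lambda>t. root (2 * t + 1) (real (walk_count V E r S (2 * t + 1)))) \<longlonglongrightarrow> g d \<alpha>)"
proof -
  obtain q where d_q: "d = Suc q" "1 \<le> q" using assms(1) by (cases d) auto
  interpret rooted_regular_tree V E d r q
    using assms d_q by (simp add: rooted_regular_tree_def rooted_regular_tree_axioms_def)
  let ?a = "nb_walk_count V E r S" and ?b = "walk_count V E r S"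
  interpret tree_walk_transform q ?a ?b
    by unfold_locales (use d_q walk_count_eq assms in auto)
  have g_d: "g (Suc q) = g d" using d_q(1) by simp
  have even: "(\<lambda>t. root (2 * t) (?b (2 * t))) \<longlonglongrightarrow> g d \<alpha>"
    if lim: "(\<lambda>t. root (2 * t) (?a (2 * t))) \<longlonglongrightarrow> \<alpha>" and ne: "even_part V E r S \<noteq> {}" for \<alpha>
  proof -
    obtain v where "v \<in> S" "even (depth v)" using ne by (auto simp: even_part_def)
    then show ?thesis
      using walk_root_limit[of 0 "depth v" \<alpha>] lim nb_walk_count_pos[OF assms(4), of v]
      unfolding g_d by simp
  qed
  have odd: "(\<lambda>t. root (2 * t + 1) (?b (2 * t + 1))) \<longlonglongrightarrow> g d \<alpha>"
    if lim: "(\<lambda>t. root (2 * t + 1) (?a (2 * t + 1))) \<longlonglongrightarrow> \<alpha>" and ne: "odd_part V E r S \<noteq> {}" for \<alpha>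
  proof -
    obtain v where "v \<in> S" "odd (depth v)" using ne by (auto simp: odd_part_def)
    then show ?thesis
      using walk_root_limit[of 1 "depth v" \<alpha>] lim nb_walk_count_pos[OF assms(4), of v]
      unfolding g_d by simp
  qed
  \<comment> \<open>Both parity subsequences of the non-backtracking roots inherit the limit; the
    two limits obtained for all walks are then merged by parity.\<close>
  have all: "(\<lambda>t. root t (?b t)) \<longlonglongrightarrow> g d \<alpha>"
    if lim: "(\<lambda>t. root t (?a t)) \<longlonglongrightarrow> \<alpha>" and ne: "even_part V E r S \<noteq> {}" "odd_part V E r S \<noteq> {}" for \<alpha>
  proof -
    have "strict_mono (\<lambda>t::nat. 2 * t)" "strict_mono (\<lambda>t::nat. 2 * t + 1)"
      by (auto simp: strict_mono_def)
    from LIMSEQ_subseq_LIMSEQ[OF lim this(1)] LIMSEQ_subseq_LIMSEQ[OF lim this(2)]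
    have ev: "(\<lambda>t. root (2 * t + 0) (?b (2 * t + 0))) \<longlonglongrightarrow> g d \<alpha>"
      and od: "(\<lambda>t. root (2 * t + 1) (?b (2 * t + 1))) \<longlonglongrightarrow> g d \<alpha>"
      using even odd ne by (auto simp: o_def)
    have "\<forall>\<^sub>F n in sequentially. dist (root n (?b n)) (g d \<alpha>) < \<epsilon>" if "0 < \<epsilon>" for \<epsilon>
    proof -
      let ?P = "\<lambda>n. dist (root n (?b n)) (g d \<alpha>) < \<epsilon>"
      have "\<forall>\<^sub>F n in sequentially. even (n + 0) \<longrightarrow> ?P n" "\<forall>\<^sub>F n in sequentially. even (n + 1) \<longrightarrow> ?P n"
        using tendstoD[OF ev that] tendstoD[OF od that]
          eventually_parity_iff[of 0 ?P] eventually_parity_iff[of 1 ?P] by simp_all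
      then show ?thesis by eventually_elim auto
    qed
    then show ?thesis by (rule tendstoI)
  qed
  \<comment> \<open>These bounds make the upper limit a real number. At \<open>t = 0\<close> they
    rest on the convention that \<open>root 0\<close> is 0.\<close>
  have a_root: "0 \<le> root t (?a t)" "root t (?a t) \<le> d" for t
  proof -
    show "0 \<le> root t (?a t)" by (rule real_root_ge_zero) simp
    show "root t (?a t) \<le> d"
    proof (cases "t = 0")
      case False
      have "real (?a t) \<le> real d ^ t" using nb_walk_count_le[OF assms(4), of t]
        by (simp flip: of_nat_power)
      then show ?thesis
        using False real_root_le_mono[of t "?a t" "real d ^ t"] by (simp add: real_root_power_cancel)
    qed simp
  qed
  let ?L = "limsup (\<lambda>t. ereal (root t (?a t)))"
  have "0 \<le> ?L" "?L \<le> ereal d"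
    using a_root by (auto intro!: le_Limsup Limsup_bounded)
  then obtain \<alpha> where \<alpha>: "?L = ereal \<alpha>" "0 \<le> \<alpha>" by (cases ?L) auto
  obtain v where "v \<in> S" using assms(5) by blast
  then have "limsup (\<lambda>t. ereal (root t (?b t))) = ereal (g d \<alpha>)"
    using walk_root_limsup[of "depth v" \<alpha>] \<alpha> nb_walk_count_pos[OF assms(4), of v]
    unfolding g_d by simp
  then show ?thesis using \<alpha> all even odd by blast
qed

end
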